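(* Let $F$ be a field, and let $a_1,\dots,a_d$ be positive integers (in no particular order) with $\gcd(a_1,\dots,a_d)=1$ that non-redundantly generate their numerical semigroup. Let $A=F[[t^{a_1},\dots,t^{a_d}]]$, let $c$ be a positive integer relatively prime to $a_1$, and let $\tilde A=F[[t^{a_1},t^{ca_2},\dots,t^{ca_d}]]$. If property (Q) holds for the monomial curve $A$, then property (Q) holds for the monomial curve $\tilde A$. In particular, property (Q) holds for every monomial curve obtained by finitely many successive Morales modifications from a monomial curve $F[[t^{a_1},\dots,t^{a_d}]]$ (with $\gcd(a_1,\dots,a_d)=1$ and exponents non-redundantly generating their numerical semigroup) of one of the following two types: \begin{enumerate} \item $d=4$ and the exponents are $a,a+r,a+2r,a+3r$ with $a,r$ relatively prime positive integers; \item the exponents, arranged in increasing order, have an arithmetic subsequence of length $5$, whose terms are not necessarily consecutive. \end{enumerate}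
   Context: For positive integers $a_1,\dots,a_d$ with gcd $1$ that non-redundantly generate their numerical semigroup (i.e. no $a_i$ is a non-negative integer linear combination of the others), the monomial curve $A=F[[t^{a_1},\dots,t^{a_d}]]\subset F[[t]]$ is written as $R/P$, where $R=F[[x_1,\dots,x_d]]$ and $P$, the defining ideal of $A$, is the kernel of the $F$-algebra homomorphism $R\to F[[t]]$, $x_i\mapsto t^{a_i}$. The ideal $P$ is a prime of height $d-1$. For a positive integer $n$, the $n$-th symbolic power is $P^{(n)}=P^nR_P\cap R=\{x\in R \mid \exists\, s\in R\setminus P,\ sx\in P^n\}$. Property (Q) for the monomial curve $A$ is the implication: if $P^n=P^{(n)}$ for all positive integers $n\le \operatorname{ht}P=d-1$, then $P^n=P^{(n)}$ for all positive integers $n$. A Morales modification of the monomial curve with exponents $a_1,\dots,a_d$ is a monomial curve obtained by choosing one of the exponents (labelled $a_1$ after reordering) and a positive integer $c$ relatively prime to it, keeping the chosen exponent and multiplying all other exponents by $c$. The resulting exponents $a_1,ca_2,\dots,ca_d$ again have gcd $1$ and non-redundantly generate their numerical semigroup. *)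

theory Defs
  imports
    "HOL-Computational_Algebra.Formal_Power_Series"
    "HOL-Algebra.Ideal_Product"
    "HOL-Algebra.Algebraic_Closure_Type"
    "HOL-Library.Extended_Nat"
    "HOL-Library.Sublist"
begin

section \<open>Formal power series in finitely many variables\<close>

text \<open>
  The variables are indexed by a finite type \<^typ>\<open>'n\<close>; a monomial is its exponent vector
  \<^typ>\<open>'n \<Rightarrow> nat\<close>, and a power series is the family of its coefficients.
\<close>

typedef ('a, 'n) mfps = "UNIV :: (('n \<Rightarrow> nat) \<Rightarrow> 'a) set"
  morphisms mfps_nth Abs_mfps
  by simp

lemma mfps_eqI: "(\<And>m. mfps_nth f m = mfps_nth g m) \<Longrightarrow> f = g"
  by (simp add: mfps_nth_inject [symmetric] fun_eq_iff)

lemma mfps_nth_Abs [simp]: "mfps_nth (Abs_mfps f) = f"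
  by (simp add: Abs_mfps_inverse)

definition mono_splits :: "('n \<Rightarrow> nat) \<Rightarrow> (('n \<Rightarrow> nat) \<times> ('n \<Rightarrow> nat)) set" where
  "mono_splits m = {(u, v). (\<lambda>i. u i + v i) = m}"

lemma finite_mono_splits [simp, intro]: "finite (mono_splits (m :: 'n :: finite \<Rightarrow> nat))"
proof -
  define B where "B = Max (range m)"
  have B: "m i \<le> B" for i
    by (simp add: B_def)
  have fin: "finite {u :: 'n \<Rightarrow> nat. range u \<subseteq> {..B}}"
    using finite_set_of_finite_funs[of "UNIV :: 'n set" "{..B}" 0] by (simp add: image_subset_iff)
  have "mono_splits m \<subseteq> {u. range u \<subseteq> {..B}} \<times> {u. range u \<subseteq> {..B}}"
  proof (clarsimp simp: mono_splits_def, safe)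
    fix u v :: "'n \<Rightarrow> nat" and i
    assume "m = (\<lambda>i. u i + v i)"
    then show "u i \<le> B" "v i \<le> B"
      using B[of i] by auto
  qed
  then show ?thesis
    using fin by (meson finite_SigmaI finite_subset)
qed

instantiation mfps :: (comm_ring_1, finite) comm_ring_1
begin

definition zero_mfps :: "('a, 'b) mfps" where
  "0 = Abs_mfps (\<lambda>m. 0)"

definition one_mfps :: "('a, 'b) mfps" where
  "1 = Abs_mfps (\<lambda>m. if m = (\<lambda>i. 0) then 1 else 0)"

definition plus_mfps :: "('a, 'b) mfps \<Rightarrow> ('a, 'b) mfps \<Rightarrow> ('a, 'b) mfps" where
  "f + g = Abs_mfps (\<lambda>m. mfps_nth f m + mfps_nth g m)"

definition minus_mfps :: "('a, 'b) mfps \<Rightarrow> ('a, 'b) mfps \<Rightarrow> ('a, 'b) mfps" where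
  "f - g = Abs_mfps (\<lambda>m. mfps_nth f m - mfps_nth g m)"

definition uminus_mfps :: "('a, 'b) mfps \<Rightarrow> ('a, 'b) mfps" where
  "- f = Abs_mfps (\<lambda>m. - mfps_nth f m)"

definition times_mfps :: "('a, 'b) mfps \<Rightarrow> ('a, 'b) mfps \<Rightarrow> ('a, 'b) mfps" where
  "f * g = Abs_mfps (\<lambda>m. \<Sum>(u, v) \<in> mono_splits m. mfps_nth f u * mfps_nth g v)"

instance
proof
  fix f g h :: "('a, 'b) mfps"
  show "f + g + h = f + (g + h)" "f + g = g + f" "0 + f = f" "- f + f = 0" "f - g = f + - g"
    by (simp_all add: plus_mfps_def zero_mfps_def minus_mfps_def uminus_mfps_def
        algebra_simps Abs_mfps_inject mfps_nth_inverse)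
  show "(0 :: ('a, 'b) mfps) \<noteq> 1"
    by (auto simp: zero_mfps_def one_mfps_def Abs_mfps_inject fun_eq_iff)
  show "(f + g) * h = f * h + g * h"
    by (simp add: plus_mfps_def times_mfps_def distrib_right sum.distrib case_prod_unfold)
  show "f * g = g * f"
  proof (rule mfps_eqI)
    fix m
    show "mfps_nth (f * g) m = mfps_nth (g * f) m"
      unfolding times_mfps_def mfps_nth_Abs
      by (rule sum.reindex_bij_witness[of _ prod.swap prod.swap])
         (auto simp: mono_splits_def add.commute mult.commute)
  qed
  show "1 * f = f"
  proof (rule mfps_eqI)
    fix m
    have "mfps_nth (1 * f) m
        = (\<Sum>(u, v) \<in> mono_splits m. if u = (\<lambda>i. 0) then mfps_nth f v else 0)"
      unfolding times_mfps_def one_mfps_def mfps_nth_Abs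
      by (rule sum.cong) auto
    also have "\<dots> = (\<Sum>(u, v) \<in> {((\<lambda>i :: 'b. 0 :: nat), m)}. if u = (\<lambda>i. 0) then mfps_nth f v else 0)"
      by (rule sum.mono_neutral_right, simp) (auto simp: mono_splits_def split: if_splits)
    finally show "mfps_nth (1 * f) m = mfps_nth f m"
      by simp
  qed
  show "f * g * h = f * (g * h)"
  proof (rule mfps_eqI)
    fix m
    have "mfps_nth (f * g * h) m = (\<Sum>(p, w) \<in> mono_splits m. \<Sum>(u, v) \<in> mono_splits p.
            mfps_nth f u * mfps_nth g v * mfps_nth h w)"
      by (simp add: times_mfps_def sum_distrib_right case_prod_unfold)
    also have "\<dots> = (\<Sum>((p, w), (u, v)) \<in> Sigma (mono_splits m) (\<lambda>(p, w). mono_splits p).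
            mfps_nth f u * mfps_nth g v * mfps_nth h w)"
      by (subst sum.Sigma [symmetric]) (auto simp: case_prod_unfold)
    also have "\<dots> = (\<Sum>((u, q), (v, w)) \<in> Sigma (mono_splits m) (\<lambda>(u, q). mono_splits q).
            mfps_nth f u * (mfps_nth g v * mfps_nth h w))"
      by (rule sum.reindex_bij_witness
            [of _ "\<lambda>((u, q), (v, w)). (((\<lambda>i. u i + v i), w), (u, v))"
                  "\<lambda>((p, w), (u, v)). ((u, (\<lambda>i. v i + w i)), (v, w))"])
         (auto simp: mono_splits_def algebra_simps)
    also have "\<dots> = (\<Sum>(u, q) \<in> mono_splits m. \<Sum>(v, w) \<in> mono_splits q.
            mfps_nth f u * (mfps_nth g v * mfps_nth h w))"
      by (subst sum.Sigma [symmetric]) (auto simp: case_prod_unfold)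
    also have "\<dots> = mfps_nth (f * (g * h)) m"
      by (simp add: times_mfps_def sum_distrib_left case_prod_unfold)
    finally show "mfps_nth (f * g * h) m = mfps_nth (f * (g * h)) m" .
  qed
qed

end

lemma mfps_nth_ops [simp]:
  "mfps_nth 0 m = 0"
  "mfps_nth 1 m = (if m = (\<lambda>i. 0) then 1 else 0)"
  "mfps_nth (f + g) m = mfps_nth f m + mfps_nth g m"
  "mfps_nth (f - g) m = mfps_nth f m - mfps_nth g m"
  "mfps_nth (- f) m = - mfps_nth f m"
  by (simp_all add: zero_mfps_def one_mfps_def plus_mfps_def minus_mfps_def uminus_mfps_def)

lemma mfps_nth_mult:
  "mfps_nth (f * g) m = (\<Sum>(u, v) \<in> mono_splits m. mfps_nth f u * mfps_nth g v)"
  by (simp add: times_mfps_def)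

definition mfps_const :: "'a :: comm_ring_1 \<Rightarrow> ('a, 'n :: finite) mfps" where
  "mfps_const c = Abs_mfps (\<lambda>m. if m = (\<lambda>i. 0) then c else 0)"

definition mfps_X :: "'n \<Rightarrow> ('a :: comm_ring_1, 'n :: finite) mfps" where
  "mfps_X i = Abs_mfps (\<lambda>m. if m = (\<lambda>j. if j = i then 1 else 0) then 1 else 0)"


section \<open>Ideals: symbolic powers and height\<close>

text \<open>Ordinary powers of ideals are powers in the monoid \<^term>\<open>ideals_set R\<close>.\<close>

abbreviation ideal_power :: "('a, 'b) ring_scheme \<Rightarrow> 'a set \<Rightarrow> nat \<Rightarrow> 'a set" where
  "ideal_power R I n \<equiv> I [^]\<^bsub>ideals_set R\<^esub> n"

definition symbolic_power :: "('a, 'b) ring_scheme \<Rightarrow> 'a set \<Rightarrow> nat \<Rightarrow> 'a set" where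
  "symbolic_power R P n =
     {x \<in> carrier R. \<exists>s \<in> carrier R - P. s \<otimes>\<^bsub>R\<^esub> x \<in> ideal_power R P n}"

text \<open>
  The height of a prime ideal is the supremum of the lengths of strictly increasing
  chains of prime ideals ending in it.
\<close>

definition ideal_height :: "('a, 'b) ring_scheme \<Rightarrow> 'a set \<Rightarrow> enat" where
  "ideal_height R P = Sup {enat n | n. \<exists>p :: nat \<Rightarrow> 'a set.
     (\<forall>i\<le>n. primeideal (p i) R) \<and> (\<forall>i<n. p i \<subset> p (Suc i)) \<and> p n = P}"


section \<open>Monomial curves\<close>

definition curve_exponents :: "('n :: finite \<Rightarrow> nat) \<Rightarrow> bool" where
  "curve_exponents a \<longleftrightarrow>
     (\<forall>i. 0 < a i) \<and> Gcd (range a) = 1 \<and>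
     (\<forall>i. \<not> (\<exists>k :: 'n \<Rightarrow> nat. a i = (\<Sum>j\<in>UNIV - {i}. k j * a j)))"

text \<open>
  The substitution \<open>x\<^sub>i \<mapsto> t ^ a i\<close>: the coefficient of \<open>t ^ k\<close> in the image collects the
  coefficients of all monomials of weight \<open>k\<close>.  There are finitely many of these because the
  weights \<open>a i\<close> are positive; for other \<open>a\<close> the definition is of no significance.
\<close>

definition curve_hom :: "('n :: finite \<Rightarrow> nat) \<Rightarrow> ('a :: field, 'n) mfps \<Rightarrow> 'a fps" where
  "curve_hom a f = Abs_fps (\<lambda>k. \<Sum>m | (\<Sum>i\<in>UNIV. a i * m i) = k. mfps_nth f m)"

lemma finite_weight:
  fixes a :: "'n :: finite \<Rightarrow> nat"
  assumes "\<And>i. 0 < a i"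
  shows "finite {m :: 'n \<Rightarrow> nat. (\<Sum>i\<in>UNIV. a i * m i) = k}"
proof -
  have fin: "finite {u :: 'n \<Rightarrow> nat. range u \<subseteq> {..k}}"
    using finite_set_of_finite_funs[of "UNIV :: 'n set" "{..k}" 0] by (simp add: image_subset_iff)
  have "m i \<le> k" if "(\<Sum>i\<in>UNIV. a i * m i) = k" for m :: "'n \<Rightarrow> nat" and i
  proof -
    have "m i \<le> a i * m i"
      using assms[of i] by simp
    also have "\<dots> \<le> (\<Sum>i\<in>UNIV. a i * m i)"
      by (rule member_le_sum) auto
    finally show ?thesis
      using that by simp
  qed
  then show ?thesis
    by (intro finite_subset[OF _ fin]) auto
qed

lemma curve_hom_add:
  "curve_hom a (f + g) = curve_hom a f + curve_hom a g"
  by (simp add: curve_hom_def fps_eq_iff sum.distrib)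

lemma curve_hom_mult:
  assumes pos: "\<And>i. 0 < a i"
  shows "curve_hom a (f * g) = curve_hom a f * curve_hom a g"
proof (rule fps_ext)
  fix k
  let ?w = "\<lambda>m. \<Sum>i\<in>UNIV. a i * m i"
  let ?W = "\<lambda>k. {m. ?w m = k}"
  note fin = finite_weight[of a, OF pos]
  have "fps_nth (curve_hom a (f * g)) k
      = (\<Sum>(m, (u, v)) \<in> Sigma (?W k) mono_splits. mfps_nth f u * mfps_nth g v)"
    unfolding curve_hom_def mfps_nth_mult
    by (subst sum.Sigma [symmetric]) (auto simp: fin)
  also have "\<dots> = (\<Sum>(j, (u, v)) \<in> Sigma {0..k} (\<lambda>j. ?W j \<times> ?W (k - j)).
                     mfps_nth f u * mfps_nth g v)"
    by (rule sum.reindex_bij_witness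
          [of _ "\<lambda>(j, (u, v)). ((\<lambda>i. u i + v i), (u, v))" "\<lambda>(m, (u, v)). (?w u, (u, v))"])
       (auto simp: mono_splits_def algebra_simps sum.distrib)
  also have "\<dots> = (\<Sum>j = 0..k. \<Sum>(u, v) \<in> ?W j \<times> ?W (k - j). mfps_nth f u * mfps_nth g v)"
    by (subst sum.Sigma [symmetric]) (auto simp: fin)
  also have "\<dots> = fps_nth (curve_hom a f * curve_hom a g) k"
    by (simp add: curve_hom_def fps_mult_nth sum_product sum.cartesian_product)
  finally show "fps_nth (curve_hom a (f * g)) k = fps_nth (curve_hom a f * curve_hom a g) k" .
qed

lemma curve_hom_const:
  assumes pos: "\<And>i. 0 < a i"
  shows "curve_hom a (mfps_const c) = fps_const c"
proof (rule fps_ext)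
  fix k
  show "fps_nth (curve_hom a (mfps_const c)) k = fps_nth (fps_const c) k"
    using finite_weight[of a k, OF pos]
    by (simp add: curve_hom_def mfps_const_def sum.delta)
qed

lemma curve_hom_X:
  assumes pos: "\<And>i. 0 < a i"
  shows "curve_hom a (mfps_X i) = fps_X ^ a i"
proof (rule fps_ext)
  fix k
  have "(\<Sum>j\<in>UNIV. a j * (if j = i then 1 else 0)) = a i"
    by (simp add: if_distrib cong: if_cong)
  then show "fps_nth (curve_hom a (mfps_X i)) k = fps_nth (fps_X ^ a i) k"
    using finite_weight[of a k, OF pos]
    by (auto simp: curve_hom_def mfps_X_def sum.delta fps_X_power_nth)
qed

definition mfps_ring :: "('a :: field, 'n :: finite) mfps ring" where
  "mfps_ring = ring_of_type_algebra"

definition defining_ideal :: "('n :: finite \<Rightarrow> nat) \<Rightarrow> ('a :: field, 'n) mfps set" where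
  "defining_ideal a = a_kernel mfps_ring (ring_of_type_algebra :: 'a fps ring) (curve_hom a)"

text \<open>The field enters only as a type, so it is passed as an \<^typ>\<open>'a itself\<close> argument.\<close>

definition property_Q :: "'a :: field itself \<Rightarrow> ('n :: finite \<Rightarrow> nat) \<Rightarrow> bool" where
  "property_Q F a \<longleftrightarrow>
     (let R = (mfps_ring :: ('a, 'n) mfps ring); P = defining_ideal a in
       (\<forall>n\<ge>1. enat n \<le> ideal_height R P \<longrightarrow> ideal_power R P n = symbolic_power R P n) \<longrightarrow>
       (\<forall>n\<ge>1. ideal_power R P n = symbolic_power R P n))"

definition morales :: "'n \<Rightarrow> nat \<Rightarrow> ('n \<Rightarrow> nat) \<Rightarrow> ('n \<Rightarrow> nat)" where
  "morales i c a = (\<lambda>j. if j = i then a j else c * a j)"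

definition morales_modification :: "('n \<Rightarrow> nat) \<Rightarrow> ('n \<Rightarrow> nat) \<Rightarrow> bool" where
  "morales_modification a b \<longleftrightarrow> (\<exists>i c. 0 < c \<and> coprime c (a i) \<and> b = morales i c a)"

definition arithmetic_four :: "('n :: finite \<Rightarrow> nat) \<Rightarrow> bool" where
  "arithmetic_four a \<longleftrightarrow> card (UNIV :: 'n set) = 4 \<and>
     (\<exists>b r. 0 < b \<and> 0 < r \<and> coprime b r \<and> range a = {b, b + r, b + 2 * r, b + 3 * r})"

text \<open>
  The sorted list is strictly increasing, so a common difference \<open>r\<close> as below is positive.
\<close>

definition arithmetic_subseq_five :: "('n :: finite \<Rightarrow> nat) \<Rightarrow> bool" where
  "arithmetic_subseq_five a \<longleftrightarrow>
     (\<exists>b r. subseq [b, b + r, b + 2 * r, b + 3 * r, b + 4 * r] (sorted_list_of_set (range a)))"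

end

theory Submission
  imports Defs
begin

text \<open>
  The Morales modification replaces \<open>P\<close> by its extension along \<open>x\<^sub>i \<mapsto> x\<^sub>i ^ c\<close>, which makes \<open>R\<close> a free
  module over itself with basis \<open>1, x\<^sub>i, \<dots>, x\<^sub>i ^ (c - 1)\<close>.  Hence powers can be compared
  componentwise.  Symbolic powers can too, because every element outside the extended ideal divides
  some power of \<open>x\<^sub>i ^ c\<close> modulo that ideal; and the height does not drop, by going down along the
  free extension.

  For the two arithmetic types the hypothesis of (Q) fails: already \<open>P\<^sup>2 \<noteq> P\<^sup>(\<^sup>2\<^sup>)\<close>, or
  \<open>P\<^sup>3 \<noteq> P\<^sup>(\<^sup>3\<^sup>)\<close> when \<open>d = 4\<close> and \<open>a \<equiv> 2\<close> modulo \<open>3\<close>.  An explicit element of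
  the symbolic power is built from Hankel minors, and a coefficient or a weight shows
  that it is not in the ordinary power.
\<close>

section \<open>Ideals of commutative rings given by type classes\<close>

text \<open>Only inequalities for the height occur. The hypothesis of (Q) for the modified curve
  covers all \<open>n\<close> up to the height of the extended ideal, so it transfers to
  \<open>P\<close> as soon as that height is at least the height of \<open>P\<close>. For the
  arithmetic types a failure at \<open>n\<close> counts only if \<open>n\<close> is at most the
  height of \<open>P\<close>; an explicit chain of primes with \<open>d - 1\<close> strict
  inclusions gives this for every \<open>n < d\<close>, and the cube is admissible because
  \<open>d = 4\<close> there. The obstacle in comparing symbolic powers is that a multiplier
  \<open>s\<close> outside the extended ideal need not come from the subring. A power of
  \<open>x_i ^ c\<close> does, and it can replace \<open>s\<close> because the curve contains every
  series of large order. The witnesses arise by division: a combination that lies in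
  \<open>P ^ n\<close> and is divisible by \<open>x_1\<close> is divided by \<open>x_1\<close>. The
  quotient lies in the symbolic power because \<open>x_1\<close> is outside
  \<open>P\<close>.\<close>

lemma type_ring_simps [simp]:
  "carrier (ring_of_type_algebra :: 'a :: comm_ring_1 ring) = UNIV"
  "x \<otimes>\<^bsub>(ring_of_type_algebra :: 'a ring)\<^esub> y = x * y"
  "\<one>\<^bsub>(ring_of_type_algebra :: 'a ring)\<^esub> = 1"
  "\<zero>\<^bsub>(ring_of_type_algebra :: 'a ring)\<^esub> = 0"
  "x \<oplus>\<^bsub>(ring_of_type_algebra :: 'a ring)\<^esub> y = x + y"
  by (simp_all add: ring_of_type_algebra_def)

lemma ideal_type_iff:
  "ideal I (ring_of_type_algebra :: 'a :: comm_ring_1 ring) \<longleftrightarrow>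
     0 \<in> I \<and> (\<forall>x\<in>I. \<forall>y\<in>I. x + y \<in> I) \<and> (\<forall>x\<in>I. \<forall>r. r * x \<in> I)"
proof (intro iffI conjI ballI allI)
  let ?R = "ring_of_type_algebra :: 'a ring"
  assume "ideal I ?R"
  then interpret ideal I ?R .
  show "0 \<in> I" using additive_subgroup.zero_closed[OF is_additive_subgroup] by simp
  show "x + y \<in> I" if "x \<in> I" "y \<in> I" for x y
    using additive_subgroup.a_closed[OF is_additive_subgroup that] by simp
  show "r * x \<in> I" if "x \<in> I" for x r
    using I_l_closed[OF that, of r] by simp
next
  let ?R = "ring_of_type_algebra :: 'a ring"
  interpret cring ?R by (rule cring_from_type_algebra)
  assume I: "0 \<in> I \<and> (\<forall>x\<in>I. \<forall>y\<in>I. x + y \<in> I) \<and> (\<forall>x\<in>I. \<forall>r. r * x \<in> I)"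
  have minus: "\<ominus>\<^bsub>?R\<^esub> x = - 1 * x" for x
    by (rule minus_equality) simp_all
  show "ideal I ?R"
  proof (rule idealI)
    show "ring ?R" by (rule ring_axioms)
    show "subgroup I (add_monoid ?R)"
    proof (rule add.subgroupI)
      fix x assume "x \<in> I"
      then show "\<ominus>\<^bsub>?R\<^esub> x \<in> I"
        using I minus[of x] by metis
    qed (use I in auto)
  qed (use I in \<open>auto simp: mult.commute\<close>)
qed

lemma primeideal_type_iff:
  "primeideal I (ring_of_type_algebra :: 'a :: comm_ring_1 ring) \<longleftrightarrow>
     ideal I (ring_of_type_algebra :: 'a ring) \<and> 1 \<notin> I \<and> (\<forall>x y. x * y \<in> I \<longrightarrow> x \<in> I \<or> y \<in> I)"
proof (intro iffI conjI allI impI)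
  let ?R = "ring_of_type_algebra :: 'a ring"
  assume "primeideal I ?R"
  then interpret primeideal I ?R .
  show "ideal I ?R" by (rule ideal_axioms)
  show "1 \<notin> I" using one_imp_carrier I_notcarr by auto
  show "x \<in> I \<or> y \<in> I" if "x * y \<in> I" for x y
    using I_prime[of x y] that by simp
next
  assume "ideal I (ring_of_type_algebra :: 'a ring) \<and> 1 \<notin> I \<and> (\<forall>x y. x * y \<in> I \<longrightarrow> x \<in> I \<or> y \<in> I)"
  then show "primeideal I (ring_of_type_algebra :: 'a ring)"
    by (intro primeidealI cring_from_type_algebra) auto
qed

context
  fixes I :: "'a :: comm_ring_1 set"
  assumes I: "ideal I ring_of_type_algebra"
begin

lemma ideal_zero: "0 \<in> I"
  and ideal_add: "x \<in> I \<Longrightarrow> y \<in> I \<Longrightarrow> x + y \<in> I"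
  and ideal_mult_left: "x \<in> I \<Longrightarrow> r * x \<in> I"
  using I by (auto simp: ideal_type_iff)

lemma ideal_mult_right: "x \<in> I \<Longrightarrow> x * r \<in> I"
  using ideal_mult_left[of x r] by (simp add: mult.commute)

lemma ideal_uminus: "x \<in> I \<Longrightarrow> - x \<in> I"
  using ideal_mult_left[of x "-1"] by simp

lemma ideal_diff: "x \<in> I \<Longrightarrow> y \<in> I \<Longrightarrow> x - y \<in> I"
  using ideal_add[of x "- y"] ideal_uminus by simp

lemma ideal_sum: "(\<And>k. k \<in> K \<Longrightarrow> g k \<in> I) \<Longrightarrow> sum g K \<in> I"
  by (induction K rule: infinite_finite_induct) (auto intro: ideal_zero ideal_add)

end

section \<open>Powers and symbolic powers of ideals\<close>

lemma ideals_set_simps [simp]: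
  "\<one>\<^bsub>ideals_set R\<^esub> = carrier R"
  "I \<otimes>\<^bsub>ideals_set R\<^esub> J = ideal_prod R I J"
  by (simp_all add: ideals_set_def)

lemma ideal_ideal_power:
  fixes I :: "'a :: comm_ring_1 set"
  assumes "ideal I ring_of_type_algebra"
  shows "ideal (ideal_power ring_of_type_algebra I n) ring_of_type_algebra"
proof (induction n)
  case 0
  show ?case by (simp add: ideal_type_iff)
next
  case (Suc n)
  interpret ring "ring_of_type_algebra :: 'a ring" by (rule ring_from_type_algebra)
  show ?case
    using ideal_prod_is_ideal[OF Suc assms] by simp
qed

lemma ideal_power_SucI:
  fixes I :: "'a :: comm_ring_1 set"
  assumes "x \<in> ideal_power ring_of_type_algebra I n" "y \<in> I"
  shows "x * y \<in> ideal_power ring_of_type_algebra I (Suc n)"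
  using ideal_prod.prod[OF assms, of ring_of_type_algebra] by simp

lemma ideal_power_1I: "x \<in> I \<Longrightarrow> x \<in> ideal_power ring_of_type_algebra (I :: 'a :: comm_ring_1 set) (Suc 0)"
  using ideal_power_SucI[of 1 I 0 x] by simp

lemma ideal_power_2I: 
  "x \<in> I \<Longrightarrow> y \<in> I \<Longrightarrow> x * y \<in> ideal_power ring_of_type_algebra (I :: 'a :: comm_ring_1 set) 2"
  using ideal_power_SucI[of x I "Suc 0" y] ideal_power_1I[of x I] by (simp add: numeral_2_eq_2)

lemma ideal_power_3I: 
  "x \<in> I \<Longrightarrow> y \<in> I \<Longrightarrow> z \<in> I \<Longrightarrow> 
     x * y * z \<in> ideal_power ring_of_type_algebra (I :: 'a :: comm_ring_1 set) 3"
  using ideal_power_SucI[of "x * y" I 2 z] ideal_power_2I[of x I y] by (simp add: numeral_3_eq_3 numeral_2_eq_2)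

lemma power_in_ideal_power:
  "x \<in> I \<Longrightarrow> x ^ n \<in> ideal_power ring_of_type_algebra (I :: 'a :: comm_ring_1 set) n"
  by (induction n) (auto simp del: nat_pow_Suc simp: mult.commute[of x] intro: ideal_power_SucI)

lemma ideal_power_Suc_induct [consumes 1, case_names mult add]:
  fixes I :: "'a :: comm_ring_1 set"
  assumes "x \<in> ideal_power ring_of_type_algebra I (Suc n)"
    and "\<And>u v. u \<in> ideal_power ring_of_type_algebra I n \<Longrightarrow> v \<in> I \<Longrightarrow> Q (u * v)"
    and "\<And>u v. Q u \<Longrightarrow> Q v \<Longrightarrow> Q (u + v)"
  shows "Q x"
  using assms(1) unfolding nat_pow_Suc ideals_set_simps
  by (induction rule: ideal_prod.induct) (auto intro: assms(2,3))

lemma symbolic_power_type: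
  "symbolic_power ring_of_type_algebra (P :: 'a :: comm_ring_1 set) n =
     {x. \<exists>s. s \<notin> P \<and> s * x \<in> ideal_power ring_of_type_algebra P n}"
  by (auto simp: symbolic_power_def)

lemma ideal_power_subset_symbolic_power:
  fixes P :: "'a :: comm_ring_1 set"
  assumes "1 \<notin> P"
  shows "ideal_power ring_of_type_algebra P n \<subseteq> symbolic_power ring_of_type_algebra P n"
  using assms by (auto simp: symbolic_power_type intro!: exI[of _ 1])

text \<open>An ideal maximal among those containing \<open>I\<close> and avoiding \<open>M\<close> is prime.\<close>

lemma exists_primeideal_disjoint:
  fixes I M :: "'a :: comm_ring_1 set"
  assumes I: "ideal I ring_of_type_algebra"
    and M: "1 \<in> M" "\<And>x y. x \<in> M \<Longrightarrow> y \<in> M \<Longrightarrow> x * y \<in> M"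
    and disj: "I \<inter> M = {}"
  shows "\<exists>Q. primeideal Q ring_of_type_algebra \<and> I \<subseteq> Q \<and> Q \<inter> M = {}"
proof -
  define A where "A = {J. ideal J ring_of_type_algebra \<and> I \<subseteq> J \<and> J \<inter> M = {}}"
  have "\<exists>Q\<in>A. (\<forall>J\<in>A. Q \<subseteq> J \<longrightarrow> J = Q)"
  proof (rule subset_Zorn_nonempty)
    show "A \<noteq> {}" using I disj by (auto simp: A_def)
    fix C assume C: "C \<noteq> {}" "subset.chain A C"
    then have CA: "C \<subseteq> A" and tot: "\<And>J K. J \<in> C \<Longrightarrow> K \<in> C \<Longrightarrow> J \<subseteq> K \<or> K \<subseteq> J"
      by (auto simp: subset_chain_def)
    have id: "ideal J ring_of_type_algebra" if "J \<in> C" for J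
      using CA that by (auto simp: A_def)
    have "ideal (\<Union>C) ring_of_type_algebra"
      unfolding ideal_type_iff
    proof (intro conjI ballI allI)
      show "0 \<in> \<Union>C" using C(1) ideal_zero[OF id] by blast
      fix x assume "x \<in> \<Union>C"
      then obtain J where J: "J \<in> C" "x \<in> J" by blast
      show "r * x \<in> \<Union>C" for r using J ideal_mult_left[OF id] by blast
      fix y assume "y \<in> \<Union>C"
      then obtain K where K: "K \<in> C" "y \<in> K" by blast
      have "\<exists>Z\<in>C. x \<in> Z \<and> y \<in> Z" using tot[OF J(1) K(1)] J K by blast
      then show "x + y \<in> \<Union>C" using ideal_add[OF id] by blast
    qed
    moreover have "I \<subseteq> \<Union>C" using C(1) CA by (auto simp: A_def)
    moreover have "\<Union>C \<inter> M = {}" using CA by (auto simp: A_def)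
    ultimately show "\<Union>C \<in> A" by (simp add: A_def)
  qed
  then obtain Q where Q: "ideal Q ring_of_type_algebra" "I \<subseteq> Q" "Q \<inter> M = {}"
    and max: "\<And>J. ideal J ring_of_type_algebra \<Longrightarrow> I \<subseteq> J \<Longrightarrow> J \<inter> M = {} \<Longrightarrow> Q \<subseteq> J \<Longrightarrow> J = Q"
    by (auto simp: A_def)
  \<comment> \<open>By maximality the ideal \<open>J\<close> generated by \<open>Q\<close> and
    \<open>x\<close> meets \<open>M\<close>. If \<open>x\<close> and \<open>y\<close> were both
    outside \<open>Q\<close> but \<open>x * y\<close> inside, the product of two such elements would
    lie in \<open>M\<close> and in \<open>Q\<close>.\<close>
  have meet: "\<exists>q r. q \<in> Q \<and> q + r * x \<in> M" if "x \<notin> Q" for x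
  proof -
    define J where "J = {q + r * x | q r. q \<in> Q}"
    have "ideal J ring_of_type_algebra"
      unfolding ideal_type_iff
    proof (intro conjI ballI allI)
      show "0 \<in> J"
        unfolding J_def using ideal_zero[OF Q(1)] by (intro CollectI exI[of _ 0]) auto
      show "u + v \<in> J" if uv: "u \<in> J" "v \<in> J" for u v
      proof -
        obtain q r q' r' where "u = q + r * x" "v = q' + r' * x" "q \<in> Q" "q' \<in> Q"
          using uv unfolding J_def by blast
        then show ?thesis
          unfolding J_def using ideal_add[OF Q(1)]
          by (intro CollectI exI[of _ "q + q'"] exI[of _ "r + r'"]) (simp add: algebra_simps)
      qed
      show "s * u \<in> J" if u: "u \<in> J" for u s
      proof -
        obtain q r where "u = q + r * x" "q \<in> Q"
          using u unfolding J_def by blast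
        then show ?thesis
          unfolding J_def using ideal_mult_left[OF Q(1)]
          by (intro CollectI exI[of _ "s * q"] exI[of _ "s * r"]) (simp add: algebra_simps)
      qed
    qed
    moreover have "Q \<subseteq> J"
      unfolding J_def by (force intro: exI[of _ 0])
    moreover have "x \<in> J"
      unfolding J_def using ideal_zero[OF Q(1)] by (intro CollectI exI[of _ 0] exI[of _ 1]) simp
    ultimately have "J \<inter> M \<noteq> {}" using max[of J] Q(2) that by blast
    then show ?thesis unfolding J_def by blast
  qed
  have "x \<in> Q \<or> y \<in> Q" if xy: "x * y \<in> Q" for x y
  proof (rule ccontr)
    assume "\<not> (x \<in> Q \<or> y \<in> Q)"
    then obtain q r q' r' where h: "q \<in> Q" "q + r * x \<in> M" "q' \<in> Q" "q' + r' * y \<in> M"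
      using meet by meson
    have "(q + r * x) * (q' + r' * y) = (q' + r' * y) * q + (r * x) * q' + (r * r') * (x * y)"
      by (simp add: algebra_simps)
    also have "\<dots> \<in> Q"
      using h(1,3) xy by (blast intro: ideal_add[OF Q(1)] ideal_mult_left[OF Q(1)])
    finally show False using M(2)[OF h(2,4)] Q(3) by blast
  qed
  moreover have "1 \<notin> Q" using Q(3) M(1) by blast
  ultimately have "primeideal Q ring_of_type_algebra"
    using Q(1) by (auto simp: primeideal_type_iff)
  then show ?thesis using Q by blast
qed

section \<open>Power series and weights\<close>

definition weight :: "('n :: finite \<Rightarrow> nat) \<Rightarrow> ('n \<Rightarrow> nat) \<Rightarrow> nat" where
  "weight a m = (\<Sum>i\<in>UNIV. a i * m i)"

definition mfps_monom :: "('n \<Rightarrow> nat) \<Rightarrow> ('a :: comm_ring_1, 'n :: finite) mfps" where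
  "mfps_monom u = Abs_mfps (\<lambda>m. if m = u then 1 else 0)"

lemma mfps_nth_monom [simp]: "mfps_nth (mfps_monom u) m = (if m = u then 1 else 0)"
  by (simp add: mfps_monom_def)

lemma mfps_nth_monom_mult:
  "mfps_nth (mfps_monom u * f) m = (if \<forall>i. u i \<le> m i then mfps_nth f (\<lambda>i. m i - u i) else 0)"
proof -
  have "mfps_nth (mfps_monom u * f) m = (\<Sum>(u', v) \<in> mono_splits m. if u' = u then mfps_nth f v else 0)"
    unfolding mfps_nth_mult by (rule sum.cong) auto
  also have "\<dots> = (\<Sum>(u', v) \<in> {(u', v) \<in> mono_splits m. u' = u}. mfps_nth f v)"
    by (rule sum.mono_neutral_cong_right) (auto split: if_splits)
  also have "{(u', v) \<in> mono_splits m. u' = u} =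
      (if \<forall>i. u i \<le> m i then {(u, \<lambda>i. m i - u i)} else {})"
    by (auto simp: mono_splits_def fun_eq_iff) (metis diff_add_inverse, metis le_add1)
  finally show ?thesis
    by (simp split: if_splits)
qed

lemma mfps_monom_mult: "mfps_monom u * mfps_monom v = mfps_monom (\<lambda>i. u i + v i)"
proof (rule mfps_eqI)
  fix m
  have "(\<forall>i. u i \<le> m i) \<and> (\<lambda>i. m i - u i) = v \<longleftrightarrow> m = (\<lambda>i. u i + v i)"
    by (auto simp: fun_eq_iff) (metis le_add_diff_inverse)
  then show "mfps_nth (mfps_monom u * mfps_monom v) m = mfps_nth (mfps_monom (\<lambda>i. u i + v i)) m"
    by (auto simp: mfps_nth_monom_mult)
qed

lemma mfps_monom_0: "mfps_monom (\<lambda>i. 0) = 1"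
  by (rule mfps_eqI) simp

lemma mfps_X_power:
  "(mfps_X i :: ('a :: comm_ring_1, 'b :: finite) mfps) ^ k = mfps_monom (\<lambda>j. if j = i then k else 0)"
proof (induction k)
  case 0
  show ?case by (simp add: mfps_monom_0)
next
  case (Suc k)
  have "(mfps_X i :: ('a, 'b) mfps) = mfps_monom (\<lambda>j. if j = i then 1 else 0)"
    by (simp add: mfps_X_def mfps_monom_def)
  then have "(mfps_X i :: ('a, 'b) mfps) ^ Suc k = mfps_monom (\<lambda>j. if j = i then 1 else 0) * mfps_monom (\<lambda>j. if j = i then k else 0)"
    unfolding power_Suc Suc by simp
  moreover have "(\<lambda>j. (if j = i then 1 else 0 :: nat) + (if j = i then k else 0)) = (\<lambda>j. if j = i then Suc k else 0)"
    by auto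
  ultimately show ?case
    by (simp only: mfps_monom_mult)
qed

lemma mfps_nth_X_power_mult:
  "mfps_nth (mfps_X i ^ k * f) m = (if k \<le> m i then mfps_nth f (m(i := m i - k)) else 0)"
proof -
  have "(\<forall>j. (if j = i then k else 0) \<le> m j) \<longleftrightarrow> k \<le> m i" by auto
  moreover have "(\<lambda>j. m j - (if j = i then k else 0)) = m(i := m i - k)" by auto
  ultimately show ?thesis
    unfolding mfps_X_power mfps_nth_monom_mult by simp
qed

lemma fps_nth_curve_hom: "fps_nth (curve_hom a f) k = (\<Sum>m | weight a m = k. mfps_nth f m)"
  by (simp add: curve_hom_def weight_def)

lemma curve_hom_0 [simp]: "curve_hom a 0 = 0"
  by (rule fps_ext) (simp add: fps_nth_curve_hom)

lemma curve_hom_diff: "curve_hom a (f - g) = curve_hom a f - curve_hom a g"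
  by (rule fps_ext) (simp add: fps_nth_curve_hom sum_subtractf)

lemma curve_hom_monom:
  fixes a :: "'n :: finite \<Rightarrow> nat"
  assumes "\<And>i. 0 < a i"
  shows "curve_hom a (mfps_monom u) = fps_X ^ weight a u"
  using finite_weight[of a, OF assms]
  by (intro fps_ext) (auto simp: fps_nth_curve_hom fps_X_power_nth weight_def sum.delta)

lemma curve_hom_1:
  fixes a :: "'n :: finite \<Rightarrow> nat"
  assumes "\<And>i. 0 < a i"
  shows "curve_hom a 1 = 1"
  using curve_hom_monom[OF assms, where u = "\<lambda>i. 0"] by (simp add: mfps_monom_0 weight_def)

lemma curve_hom_power:
  fixes a :: "'n :: finite \<Rightarrow> nat"
  assumes "\<And>i. 0 < a i"
  shows "curve_hom a (f ^ n) = curve_hom a f ^ n"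
  by (induction n) (simp_all add: curve_hom_1 curve_hom_mult assms)

lemma defining_ideal_iff: "f \<in> defining_ideal a \<longleftrightarrow> curve_hom a f = 0"
  by (simp add: defining_ideal_def a_kernel_def kernel_def mfps_ring_def)

lemma primeideal_defining_ideal:
  fixes a :: "'n :: finite \<Rightarrow> nat"
  assumes "\<And>i. 0 < a i"
  shows "primeideal (defining_ideal a) ring_of_type_algebra"
  by (auto simp: primeideal_type_iff ideal_type_iff defining_ideal_iff curve_hom_add curve_hom_mult
      curve_hom_1 assms)

lemmas ideal_defining_ideal = primeideal.axioms(1)[OF primeideal_defining_ideal]

lemma mfps_X_notin_defining_ideal:
  fixes a :: "'n :: finite \<Rightarrow> nat"
  assumes "\<And>i. 0 < a i"
  shows "mfps_X i \<notin> defining_ideal a"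
  by (simp add: defining_ideal_iff curve_hom_X assms)


section \<open>Adjoining a root of a variable\<close>

text \<open>The ring endomorphism that substitutes \<open>x_i ^ c\<close> for \<open>x_i\<close>.
  Its image is the subring over which the power series ring is free.\<close>

definition dilate :: "'n \<Rightarrow> nat \<Rightarrow> ('a, 'n) mfps \<Rightarrow> ('a :: comm_ring_1, 'n :: finite) mfps" where
  "dilate i c f = Abs_mfps (\<lambda>m. if c dvd m i then mfps_nth f (m(i := m i div c)) else 0)"

text \<open>For \<open>k < c\<close> this is the coordinate of \<open>f\<close> at the basis element
  \<open>x_i ^ k\<close>, already pulled back along \<open>dilate i c\<close>.\<close>

definition residue_part ::
    "'n \<Rightarrow> nat \<Rightarrow> nat \<Rightarrow> ('a, 'n) mfps \<Rightarrow> ('a :: comm_ring_1, 'n :: finite) mfps" where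
  "residue_part i c k f = Abs_mfps (\<lambda>m. mfps_nth f (m(i := c * m i + k)))"

lemma residue_part_add: "residue_part i c k (f + g) = residue_part i c k f + residue_part i c k g"
  by (rule mfps_eqI) (simp add: residue_part_def)

lemma residue_part_0: "residue_part i c k 0 = 0"
  by (rule mfps_eqI) (simp add: residue_part_def)

lemma residue_part_sum: "residue_part i c k (sum g K) = (\<Sum>l\<in>K. residue_part i c k (g l))"
  by (induction K rule: infinite_finite_induct) (simp_all add: residue_part_add residue_part_0)

context
  fixes i :: "'n :: finite" and c :: nat
  assumes c: "0 < c"
begin

text \<open>Coordinates are linear over the subring: the first factor contributes only multiples of
  \<open>c\<close> to the exponent of \<open>x_i\<close>, so the residue \<open>k\<close> has to
  come from the second factor.\<close>

lemma residue_part_dilate_mult: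
  assumes k: "k < c"
  shows "residue_part i c k (dilate i c h * f) = h * residue_part i c k f"
proof (rule mfps_eqI)
  fix m
  let ?m = "m(i := c * m i + k)"
  let ?S = "{(u, v) \<in> mono_splits ?m. c dvd u i}"
  have "mfps_nth (residue_part i c k (dilate i c h * f)) m =
      (\<Sum>(u, v) \<in> mono_splits ?m. mfps_nth (dilate i c h) u * mfps_nth f v)"
    by (simp add: residue_part_def mfps_nth_mult)
  also have "\<dots> = (\<Sum>(u, v) \<in> ?S. mfps_nth h (u(i := u i div c)) * mfps_nth f v)"
    by (rule sum.mono_neutral_cong_right) (auto simp: dilate_def split: if_splits)
  also have "\<dots> = (\<Sum>(u, v) \<in> mono_splits m. mfps_nth h u * mfps_nth (residue_part i c k f) v)"
  proof (rule sum.reindex_bij_witness[of _ "\<lambda>(u, v). (u(i := c * u i), v(i := c * v i + k))"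
        "\<lambda>(u, v). (u(i := u i div c), v(i := v i div c))"])
    fix p assume "p \<in> ?S"
    then obtain u v where p: "p = (u, v)" "(\<lambda>j. u j + v j) = ?m" "c dvd u i"
      by (auto simp: mono_splits_def)
    then obtain x where x: "u i = c * x" by (auto elim: dvdE)
    have s: "u j + v j = ?m j" for j using p(2) by (rule fun_cong)
    have eq: "c * x + v i = c * m i + k" using s[of i] x by simp
    \<comment> \<open>Here \<open>k < c\<close> is essential: there is no carry from the residue
      into the quotient, so the quotients by \<open>c\<close> add up to \<open>m i\<close>.\<close>
    have "x \<le> m i"
    proof (rule ccontr)
      assume "\<not> x \<le> m i"
      then have "c * Suc (m i) \<le> c * x" by (intro mult_le_mono2) simp
      with eq k show False by simp
    qed
    then obtain y where y: "m i = x + y" using le_Suc_ex by blast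
    have v: "v i = c * y + k" using eq y by (simp add: algebra_simps)
    have div: "u i div c = x" "v i div c = y" using x v c k by simp_all
    show "(case case p of (u, v) \<Rightarrow> (u(i := u i div c), v(i := v i div c)) of
        (u, v) \<Rightarrow> (u(i := c * u i), v(i := c * v i + k))) = p"
      using p x v div by (auto simp: fun_eq_iff)
    show "(case p of (u, v) \<Rightarrow> (u(i := u i div c), v(i := v i div c))) \<in> mono_splits m"
      using p(1) s y div by (auto simp: mono_splits_def fun_eq_iff split: if_splits)
    show "(case case p of (u, v) \<Rightarrow> (u(i := u i div c), v(i := v i div c)) of
        (u, v) \<Rightarrow> mfps_nth h u * mfps_nth (residue_part i c k f) v) =
      (case p of (u, v) \<Rightarrow> mfps_nth h (u(i := u i div c)) * mfps_nth f v)"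
      using p(1) v div by (simp add: residue_part_def fun_upd_idem)
  next
    fix p assume "p \<in> mono_splits m"
    then obtain u v where p: "p = (u, v)" "(\<lambda>j. u j + v j) = m"
      by (auto simp: mono_splits_def)
    show "(case case p of (u, v) \<Rightarrow> (u(i := c * u i), v(i := c * v i + k)) of
        (u, v) \<Rightarrow> (u(i := u i div c), v(i := v i div c))) = p"
      using p(1) c k by (auto simp: fun_eq_iff)
    show "(case p of (u, v) \<Rightarrow> (u(i := c * u i), v(i := c * v i + k))) \<in> ?S"
      using p(1) c by (auto simp: mono_splits_def fun_eq_iff algebra_simps simp flip: p(2))
  qed
  finally show "mfps_nth (residue_part i c k (dilate i c h * f)) m =
      mfps_nth (h * residue_part i c k f) m"
    by (simp add: mfps_nth_mult)
qed

lemma residue_part_dilate: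
  assumes "k < c"
  shows "residue_part i c k (dilate i c h) = (if k = 0 then h else 0)"
proof (rule mfps_eqI)
  fix m
  have "\<not> c dvd c * m i + k" if "k \<noteq> 0"
    using that assms by (metis dvd_add_right_iff dvd_triv_left nat_dvd_not_less neq0_conv)
  then show "mfps_nth (residue_part i c k (dilate i c h)) m = mfps_nth (if k = 0 then h else 0) m"
    using c by (auto simp: residue_part_def dilate_def)
qed

lemma residue_decomposition: "f = (\<Sum>k<c. mfps_X i ^ k * dilate i c (residue_part i c k f))"
proof (rule mfps_eqI)
  fix m
  have nth: "mfps_nth (mfps_X i ^ k * dilate i c (residue_part i c k f)) m =
      (if k = m i mod c then mfps_nth f m else 0)" if k: "k < c" for k
  proof (cases "k = m i mod c")
    case True
    then have "m(i := c * ((m i - k) div c) + k) = m" 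
      by (auto simp: fun_eq_iff minus_mod_eq_mult_div)
    moreover have "k \<le> m i" "c dvd m i - k" using True by (auto simp: dvd_minus_mod)
    ultimately show ?thesis
      using True by (simp add: mfps_nth_X_power_mult dilate_def residue_part_def)
  next
    case False
    have "\<not> c dvd m i - k" if "k \<le> m i"
    proof
      assume "c dvd m i - k"
      then obtain x where "m i - k = c * x" by (elim dvdE)
      then have "m i = c * x + k" using that by simp
      then show False using False k by simp
    qed
    with False show ?thesis
      by (simp add: mfps_nth_X_power_mult dilate_def)
  qed
  have sum_nth: "mfps_nth (sum g K) m = (\<Sum>k\<in>K. mfps_nth (g k) m)"
    for g :: "nat \<Rightarrow> ('b :: comm_ring_1, 'n) mfps" and K
    by (induction K rule: infinite_finite_induct) simp_all
  show "mfps_nth f m = mfps_nth (\<Sum>k<c. mfps_X i ^ k * dilate i c (residue_part i c k f)) m"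
    unfolding sum_nth using nth c by (simp add: sum.delta)
qed

lemma mfps_eq_residueI: "(\<And>k. k < c \<Longrightarrow> residue_part i c k f = residue_part i c k g) \<Longrightarrow> f = g"
  by (subst (1 2) residue_decomposition) (intro sum.cong, simp_all)

lemma dilate_mult: "dilate i c (f * g) = dilate i c f * dilate i c g"
  by (rule mfps_eq_residueI) (simp add: residue_part_dilate_mult residue_part_dilate)

lemma dilate_add: "dilate i c (f + g) = dilate i c f + dilate i c g"
  by (rule mfps_eqI) (simp add: dilate_def)

lemma dilate_monom_single: "dilate i c (mfps_monom (\<lambda>j. if j = i then k else 0)) = mfps_X i ^ (c * k)"
proof (rule mfps_eqI)
  fix m :: "'n \<Rightarrow> nat"
  have "(c dvd m i \<and> m(i := m i div c) = (\<lambda>j. if j = i then k else 0)) \<longleftrightarrow>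
      m = (\<lambda>j. if j = i then c * k else 0)" (is "?l \<longleftrightarrow> ?r")
  proof
    assume l: ?l
    show ?r
    proof
      fix j
      have "(m(i := m i div c)) j = (if j = i then k else 0)"
        using fun_cong[OF conjunct2[OF l]] by simp
      then show "m j = (if j = i then c * k else 0)"
        using conjunct1[OF l] by (cases "j = i") auto
    qed
  next
    assume ?r
    then have "m j = (if j = i then c * k else 0)" for j by simp
    then show ?l using c by (simp add: fun_eq_iff)
  qed
  then show "mfps_nth (dilate i c (mfps_monom (\<lambda>j. if j = i then k else 0))) m = mfps_nth (mfps_X i ^ (c * k)) m"
    unfolding mfps_X_power dilate_def mfps_nth_Abs mfps_nth_monom by (smt (verit))
qed

lemma dilate_X_power: "dilate i c (mfps_X i ^ k) = mfps_X i ^ (c * k)"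
  unfolding mfps_X_power[of i k] by (rule dilate_monom_single)

lemma dilate_1: "dilate i c 1 = 1"
  using dilate_X_power[of 0] by simp

end

lemma weight_morales:
  "weight (morales i c a) m = a i * m i + c * (\<Sum>j\<in>UNIV - {i}. a j * m j)"
  unfolding weight_def
  by (subst sum.remove[of _ i]) (auto simp: morales_def sum_distrib_left mult.assoc intro!: sum.cong)

lemma weight_remove: "weight a m = a i * m i + (\<Sum>j\<in>UNIV - {i}. a j * m j)"
  unfolding weight_def by (subst sum.remove[of _ i]) auto

lemma weight_morales_upd: "weight (morales i c a) (m(i := c * m i + k)) = a i * k + c * weight a m"
  by (simp add: weight_morales weight_remove[of a m i] algebra_simps)

lemma morales_pos:
  assumes "0 < c" "\<And>j. 0 < a j"
  shows "0 < morales i c a j"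
  using assms by (simp add: morales_def)

context
  fixes i :: "'n :: finite" and c :: nat and a :: "'n \<Rightarrow> nat"
  assumes c: "0 < c" and coprime: "coprime c (a i)"
begin

text \<open>Modulo \<open>c\<close> the modified weight is \<open>a i * m i\<close>, and
  \<open>a i\<close> is invertible modulo \<open>c\<close>. Hence the degree in \<open>t\<close>
  determines the residue of \<open>m i\<close>, and the images of different basis components cannot
  interfere.\<close>

lemma weight_morales_mod:
  assumes "weight (morales i c a) m = a i * k + c * l" "k < c"
  shows "m i mod c = k"
proof -
  have "int (a i * m i + c * (\<Sum>j\<in>UNIV - {i}. a j * m j)) = int (a i * k + c * l)"
    using assms(1) by (simp only: weight_morales)
  then have "int (a i) * (int (m i) - int k) = int c * (int l - (\<Sum>j\<in>UNIV - {i}. int (a j) * int (m j)))"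
    by (simp add: algebra_simps)
  then have "int c dvd int (a i) * (int (m i) - int k)" by simp
  moreover have "coprime (int c) (int (a i))" using coprime by simp
  ultimately have "int c dvd int (m i) - int k"
    using coprime_dvd_mult_right_iff by blast
  then have "int (m i) mod int c = int k mod int c"
    by (simp add: mod_eq_dvd_iff)
  then have "m i mod c = k mod c" by (metis of_nat_eq_iff zmod_int)
  then show ?thesis using assms(2) by simp
qed

lemma curve_hom_residue_part:
  assumes k: "k < c"
  shows "fps_nth (curve_hom (morales i c a) f) (a i * k + c * l) =
    fps_nth (curve_hom a (residue_part i c k f)) l"
  unfolding fps_nth_curve_hom
proof (rule sum.reindex_bij_witness[of _ "\<lambda>m. m(i := c * m i + k)" "\<lambda>m. m(i := m i div c)"])
  fix m assume "m \<in> {m. weight (morales i c a) m = a i * k + c * l}"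
  then have w: "weight (morales i c a) m = a i * k + c * l" by simp
  have mi: "c * (m i div c) + k = m i"
    using weight_morales_mod[OF w k] by (metis mult_div_mod_eq)
  then show eq: "(m(i := m i div c))(i := c * (m(i := m i div c)) i + k) = m"
    by (simp add: fun_upd_idem)
  have "a i * k + c * weight a (m(i := m i div c)) = a i * k + c * l"
    using weight_morales_upd[of i c a "m(i := m i div c)" k] eq w by metis
  then show "m(i := m i div c) \<in> {m. weight a m = l}" using c by simp
  show "mfps_nth (residue_part i c k f) (m(i := m i div c)) = mfps_nth f m"
    using eq by (simp add: residue_part_def)
qed (use c k in \<open>auto simp: weight_morales_upd\<close>)

lemma defining_ideal_morales_iff:
  "f \<in> defining_ideal (morales i c a) \<longleftrightarrow> (\<forall>k<c. residue_part i c k f \<in> defining_ideal a)"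
proof
  assume "f \<in> defining_ideal (morales i c a)"
  then show "\<forall>k<c. residue_part i c k f \<in> defining_ideal a"
    by (auto simp: defining_ideal_iff fps_eq_iff simp flip: curve_hom_residue_part)
next
  assume *: "\<forall>k<c. residue_part i c k f \<in> defining_ideal a"
  \<comment> \<open>A degree that is the weight of some monomial has the form
    \<open>a i * k + c * l\<close> with \<open>k < c\<close>; in every other degree the sum is
    empty.\<close>
  have "fps_nth (curve_hom (morales i c a) f) n = 0" for n
  proof (cases "\<exists>m. weight (morales i c a) m = n")
    case True
    then obtain m where m: "weight (morales i c a) m = n" by blast
    define k where "k = m i mod c"
    have k: "k < c" using c by (simp add: k_def)
    have "(m(i := m i div c))(i := c * (m(i := m i div c)) i + k) = m"
      by (auto simp: k_def)
    then have "n = a i * k + c * weight a (m(i := m i div c))"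
      using weight_morales_upd[of i c a "m(i := m i div c)" k] m by simp
    then show ?thesis
      using * k by (simp add: curve_hom_residue_part defining_ideal_iff)
  next
    case False
    then show ?thesis by (simp add: fps_nth_curve_hom)
  qed
  then show "f \<in> defining_ideal (morales i c a)"
    by (simp add: defining_ideal_iff fps_eq_iff)
qed

lemma dilate_in_defining_ideal_iff:
  "dilate i c f \<in> defining_ideal (morales i c a) \<longleftrightarrow> f \<in> defining_ideal a"
proof
  assume "dilate i c f \<in> defining_ideal (morales i c a)"
  then have "residue_part i c 0 (dilate i c f) \<in> defining_ideal a"
    using c by (simp add: defining_ideal_morales_iff)
  then show "f \<in> defining_ideal a" using c by (simp add: residue_part_dilate)
next
  assume "f \<in> defining_ideal a"
  then have "residue_part i c k (dilate i c f) \<in> defining_ideal a" if "k < c" for k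
    using that c by (simp add: residue_part_dilate defining_ideal_iff)
  then show "dilate i c f \<in> defining_ideal (morales i c a)"
    by (simp add: defining_ideal_morales_iff)
qed

end

text \<open>For a free extension, the elements of an extended ideal are those whose coordinates all
  lie in the original ideal, and extension commutes with powers.\<close>

lemma ideal_power_morales_iff:
  fixes f :: "('f :: field, 'n :: finite) mfps"
  assumes c: "0 < c" "coprime c (a i)" and pos: "\<And>j. 0 < a j"
  shows "f \<in> ideal_power ring_of_type_algebra (defining_ideal (morales i c a)) n \<longleftrightarrow>
    (\<forall>k<c. residue_part i c k f \<in> ideal_power ring_of_type_algebra (defining_ideal a) n)"
proof -
  let ?a = "morales i c a"
  define pw where "pw = ideal_power ring_of_type_algebra (defining_ideal a :: ('f, 'n) mfps set)"
  define pw' where "pw' = ideal_power ring_of_type_algebra (defining_ideal ?a :: ('f, 'n) mfps set)"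
  have id: "ideal (pw n) ring_of_type_algebra" for n
    unfolding pw_def by (intro ideal_ideal_power ideal_defining_ideal pos)
  have id0: "ideal (defining_ideal ?a :: ('f, 'n) mfps set) ring_of_type_algebra"
    by (intro ideal_defining_ideal morales_pos c pos)
  have id': "ideal (pw' n) ring_of_type_algebra" for n
    unfolding pw'_def by (intro ideal_ideal_power id0)
  have down: "\<forall>k<c. residue_part i c k f \<in> pw n" if "f \<in> pw' n" for f n
    using that
  proof (induction n arbitrary: f)
    case 0
    show ?case by (simp add: pw_def)
  next
    case (Suc n)
    from Suc.prems show ?case
      unfolding pw'_def
    proof (induction f rule: ideal_power_Suc_induct)
      case (mult u p)
      then have u: "\<forall>k<c. residue_part i c k u \<in> pw n"
        using Suc.IH by (simp add: pw'_def)
      show ?case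
      proof (intro allI impI)
        fix k assume k: "k < c"
        \<comment> \<open>Only \<open>u\<close> is expanded in the basis. Each basis element is
          moved over to \<open>p\<close>, which stays in the ideal, so that linearity over the
          subring applies.\<close>
        have "u * p = (\<Sum>l<c. dilate i c (residue_part i c l u) * (mfps_X i ^ l * p))"
          by (subst residue_decomposition[OF c(1), of u i])
            (simp add: sum_distrib_right mult.assoc mult.left_commute)
        then have "residue_part i c k (u * p) =
            (\<Sum>l<c. residue_part i c l u * residue_part i c k (mfps_X i ^ l * p))"
          by (simp add: residue_part_sum residue_part_dilate_mult c k)
        also have "\<dots> \<in> pw (Suc n)"
        proof (rule ideal_sum[OF id])
          fix l assume "l \<in> {..<c}"
          then have "residue_part i c l u \<in> pw n" using u by simp
          moreover have "mfps_X i ^ l * p \<in> defining_ideal ?a"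
            by (rule ideal_mult_left[OF id0 mult(2)])
          then have "residue_part i c k (mfps_X i ^ l * p) \<in> defining_ideal a"
            using defining_ideal_morales_iff[of c a i] c k by blast
          ultimately show "residue_part i c l u * residue_part i c k (mfps_X i ^ l * p) \<in> pw (Suc n)"
            unfolding pw_def by (rule ideal_power_SucI)
        qed
        finally show "residue_part i c k (u * p) \<in> pw (Suc n)" .
      qed
    next
      case (add u v)
      then show ?case by (auto simp: residue_part_add intro: ideal_add[OF id])
    qed
  qed
  have dil: "dilate i c f \<in> pw' n" if "f \<in> pw n" for f n
    using that
  proof (induction n arbitrary: f)
    case 0
    show ?case by (simp add: pw'_def)
  next
    case (Suc n)
    from Suc.prems show ?case
      unfolding pw_def
    proof (induction f rule: ideal_power_Suc_induct)
      case (mult u p)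
      have "dilate i c p \<in> defining_ideal ?a"
        using mult(2) by (simp add: dilate_in_defining_ideal_iff c)
      moreover have "dilate i c u \<in> pw' n" using mult(1) Suc.IH by (simp add: pw_def)
      ultimately show ?case
        unfolding dilate_mult[OF c(1)] pw'_def by (intro ideal_power_SucI)
    next
      case (add u v)
      then show ?case by (auto simp: dilate_add[OF c(1)] intro: ideal_add[OF id'])
    qed
  qed
  have "f \<in> pw' n" if "\<forall>k<c. residue_part i c k f \<in> pw n"
    by (subst residue_decomposition[OF c(1), of f i])
      (use that dil in \<open>auto intro!: ideal_sum[OF id'] ideal_mult_left[OF id']\<close>)
  with down show ?thesis unfolding pw_def pw'_def by blast
qed

section \<open>Numerical semigroups\<close>

lemma bezout_finite:
  fixes a :: "'n \<Rightarrow> nat"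
  assumes "finite A"
  shows "\<exists>z. (\<Sum>j\<in>A. z j * int (a j)) = int (Gcd (a ` A))"
  using assms
proof (induction A rule: finite_induct)
  case empty
  show ?case by simp
next
  case (insert x A)
  then obtain z where z: "(\<Sum>j\<in>A. z j * int (a j)) = int (Gcd (a ` A))" by blast
  obtain u v where uv: "u * int (a x) + v * int (Gcd (a ` A)) = gcd (int (a x)) (int (Gcd (a ` A)))"
    using bezout_int by blast
  have "(\<Sum>j\<in>insert x A. (if j = x then u else v * z j) * int (a j)) =
      u * int (a x) + (\<Sum>j\<in>A. v * (z j * int (a j)))"
    using insert.hyps by (auto intro!: sum.cong)
  also have "\<dots> = int (Gcd (a ` insert x A))"
    by (simp add: uv z flip: sum_distrib_left)
  finally show ?case by (rule exI[of _ "\<lambda>j. if j = x then u else v * z j"])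
qed

lemma eventually_weight:
  fixes a :: "'n :: finite \<Rightarrow> nat"
  assumes pos: "\<And>i. 0 < a i" and gcd: "Gcd (range a) = 1"
  shows "\<exists>C. \<forall>k\<ge>C. \<exists>m. weight a m = k"
proof -
  obtain z where z: "(\<Sum>j\<in>UNIV. z j * int (a j)) = 1"
    using bezout_finite[of UNIV a] gcd by auto
  obtain i :: 'n where True by simp
  define n where "n = a i"
  have n: "0 < n" using pos by (simp add: n_def)
  show ?thesis
  proof (rule exI, intro allI impI)
    fix k assume k: "(\<Sum>j\<in>UNIV. a j * n) \<le> k"
    \<comment> \<open>The Bezout coefficients scaled by \<open>k\<close> are reduced modulo
      \<open>n = a i\<close>. The weight is then congruent to \<open>k\<close> modulo
      \<open>n\<close> and at most the assumed bound, and the missing multiple of \<open>n\<close>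
      is supplied by \<open>x_i\<close>.\<close>
    define m where "m j = nat (int k * z j mod int n)" for j
    have m: "int (m j) = int k * z j mod int n" for j
      using n by (simp add: m_def)
    have "m j \<le> n" for j
    proof -
      have "int (m j) \<le> int n" unfolding m using n by (simp add: order_less_imp_le)
      then show ?thesis by simp
    qed
    then have "weight a m \<le> k"
      unfolding weight_def by (intro order.trans[OF sum_mono k]) simp
    have "int n dvd int (weight a m) - int k * (\<Sum>j\<in>UNIV. z j * int (a j))"
    proof -
      have "int (weight a m) - int k * (\<Sum>j\<in>UNIV. z j * int (a j)) =
          (\<Sum>j\<in>UNIV. int (a j) * (int k * z j mod int n - int k * z j))"
        by (simp add: weight_def m sum_distrib_left sum_subtractf algebra_simps)
      moreover have "int n dvd (x mod int n - x)" for x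
        by (metis dvd_minus_mod dvd_minus_iff minus_diff_eq)
      ultimately show ?thesis by (auto intro!: dvd_sum)
    qed
    then have "int n dvd int k - int (weight a m)"
      using z by (simp add: dvd_diff_commute)
    then have "n dvd k - weight a m"
      using \<open>weight a m \<le> k\<close> by (metis int_dvd_int_iff of_nat_diff)
    then obtain l where l: "k - weight a m = n * l" by (elim dvdE)
    have "weight a (m(i := m i + l)) = n * l + weight a m"
      by (simp add: weight_remove[of _ _ i] n_def algebra_simps)
    then show "\<exists>m. weight a m = k"
      using l \<open>weight a m \<le> k\<close> by (intro exI[of _ "m(i := m i + l)"]) simp
  qed
qed

lemma exists_curve_hom_preimage:
  fixes a :: "'n :: finite \<Rightarrow> nat"
  assumes pos: "\<And>i. 0 < a i" and gcd: "Gcd (range a) = 1"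
  obtains C where "\<And>F :: 'f :: field fps. (\<And>k. k < C \<Longrightarrow> fps_nth F k = 0) \<Longrightarrow> \<exists>u. curve_hom a u = F"
proof -
  obtain C where "\<forall>k\<ge>C. \<exists>m. weight a m = k"
    using eventually_weight[OF assms] by blast
  then obtain M where M: "\<And>k. C \<le> k \<Longrightarrow> weight a (M k) = k" by metis
  have "\<exists>u. curve_hom a u = F" if F: "\<And>k. k < C \<Longrightarrow> fps_nth F k = 0" for F :: "'f fps"
  proof -
    \<comment> \<open>One chosen monomial \<open>M k\<close> carries the whole coefficient of degree
      \<open>k\<close>.\<close>
    define u where "u = Abs_mfps (\<lambda>m. if m = M (weight a m) then fps_nth F (weight a m) else 0)"
    have "fps_nth (curve_hom a u) k = fps_nth F k" for k
    proof -
      have "fps_nth (curve_hom a u) k =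
          (\<Sum>m\<in>{m. weight a m = k}. if m = M k then fps_nth F k else 0)"
        unfolding fps_nth_curve_hom by (rule sum.cong) (auto simp: u_def)
      also have "\<dots> = (if weight a (M k) = k then fps_nth F k else 0)"
        using finite_weight[of a k, OF pos] by (simp add: weight_def sum.delta)
      \<comment> \<open>For \<open>k < C\<close> the monomial \<open>M k\<close> is arbitrary and
        may have the wrong weight, but there the coefficient of \<open>F\<close> is zero
        anyway.\<close>
      also have "\<dots> = fps_nth F k"
        using M[of k] F[of k] by (cases "C \<le> k") auto
      finally show ?thesis .
    qed
    then show ?thesis by (auto simp: fps_eq_iff)
  qed
  then show ?thesis by (rule that)
qed

text \<open>
  The image of \<^const>\<open>curve_hom\<close> contains all power series of large order, so every nonzero
  element of the curve divides a large power of each variable.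
\<close>

lemma divides_X_power_mod_defining_ideal:
  fixes a :: "'n :: finite \<Rightarrow> nat" and s :: "('f :: field, 'n) mfps"
  assumes pos: "\<And>i. 0 < a i" and gcd: "Gcd (range a) = 1" and s: "s \<notin> defining_ideal a"
  obtains N where "\<And>n. N \<le> n \<Longrightarrow> \<exists>u. u * s - mfps_X i ^ n \<in> defining_ideal a"
proof -
  obtain C where C: "\<And>F :: 'f fps. (\<And>k. k < C \<Longrightarrow> fps_nth F k = 0) \<Longrightarrow> \<exists>u. curve_hom a u = F"
    using exists_curve_hom_preimage[OF pos gcd] by blast
  define h where "h = curve_hom a s"
  define d where "d = subdegree h"
  have h0: "h \<noteq> 0" using s by (simp add: h_def defining_ideal_iff)
  have h: "h = fps_shift d h * fps_X ^ d"
    unfolding d_def by (rule subdegree_decompose)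
  have unit: "inverse (fps_shift d h) * fps_shift d h = 1"
    using h0 by (intro inverse_mult_eq_1) (simp add: d_def)
  have "\<exists>u. u * s - mfps_X i ^ n \<in> defining_ideal a" if n: "C + d \<le> n" for n
  proof -
    have "C + d \<le> a i * n" using n pos[of i] by (metis Suc_leI le_trans mult.commute mult_le_mono1 nat_mult_1 One_nat_def)
    then obtain e where e: "a i * n = C + e + d" by (metis add.commute add.left_commute le_Suc_ex)
    \<comment> \<open>\<open>F\<close> is the quotient of \<open>t ^ (a i * n)\<close> by
      \<open>h\<close>: the order \<open>d\<close> of \<open>h\<close> is split off and the
      remaining unit inverted. The factor \<open>t ^ C\<close> that is left puts \<open>F\<close>
      into the image of \<open>curve_hom a\<close>.\<close>
    define F where "F = fps_X ^ (C + e) * inverse (fps_shift d h)"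
    have "fps_nth F k = 0" if "k < C" for k
      using that by (simp add: F_def fps_X_power_mult_nth)
    then obtain u where u: "curve_hom a u = F" using C by blast
    have "F * h = fps_X ^ (C + e) * (inverse (fps_shift d h) * fps_shift d h) * fps_X ^ d"
      unfolding F_def by (subst (2) h) (simp add: mult.assoc)
    also have "\<dots> = fps_X ^ (a i * n)" by (simp add: unit e power_add)
    finally have "curve_hom a (u * s - mfps_X i ^ n) = 0"
      by (simp add: curve_hom_diff curve_hom_mult curve_hom_power curve_hom_X pos u power_mult
          flip: h_def)
    then show ?thesis by (auto simp: defining_ideal_iff)
  qed
  then show ?thesis by (rule that)
qed

text \<open>A relation that makes a modified exponent redundant would descend to \<open>a\<close>:
  coprimality forces \<open>c = 1\<close> if the exponent is the kept one, and otherwise makes the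
  coefficient of the kept exponent divisible by \<open>c\<close>, so that \<open>c\<close>
  cancels.\<close>

lemma curve_exponents_morales:
  assumes a: "curve_exponents a" and c: "0 < c" "coprime c (a i)"
  shows "curve_exponents (morales i c a)"
  unfolding curve_exponents_def
proof (intro conjI allI notI)
  have pos: "0 < a j" for j using a by (simp add: curve_exponents_def)
  show "0 < morales i c a j" for j by (rule morales_pos[OF c(1) pos])
  show "Gcd (range (morales i c a)) = 1"
  proof -
    define g where "g = Gcd (range (morales i c a))"
    have g: "g dvd morales i c a j" for j unfolding g_def by (rule Gcd_dvd) simp
    have gi: "g dvd a i" using g[of i] by (simp add: morales_def)
    then have "coprime g c" using c(2) by (meson coprime_commute coprime_divisors dvd_refl)
    then have "g dvd a j" for j
      using g[of j] gi by (cases "j = i") (auto simp: morales_def coprime_dvd_mult_right_iff)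
    then have "g dvd Gcd (range a)" by (intro Gcd_greatest) auto
    then show ?thesis using a by (simp add: curve_exponents_def g_def)
  qed
  fix j
  assume "\<exists>k. morales i c a j = (\<Sum>l\<in>UNIV - {j}. k l * morales i c a l)"
  then obtain k where k: "morales i c a j = (\<Sum>l\<in>UNIV - {j}. k l * morales i c a l)" by blast
  have nonred: "a j \<noteq> (\<Sum>l\<in>UNIV - {j}. k l * a l)" for j k
    using a by (auto simp: curve_exponents_def)
  show False
  proof (cases "j = i")
    case True
    have "a i = (\<Sum>l\<in>UNIV - {i}. k l * (c * a l))"
      using k True by (simp add: morales_def)
    also have "\<dots> = c * (\<Sum>l\<in>UNIV - {i}. k l * a l)"
      by (simp add: sum_distrib_left mult.left_commute)
    finally have eq: "a i = c * (\<Sum>l\<in>UNIV - {i}. k l * a l)" .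
    then have "c dvd a i" by simp
    then have "c = 1" using c(2) by (metis coprime_absorb_left nat_dvd_1_iff_1)
    then show False using eq nonred[of i k] by simp
  next
    case False
    have "c * a j = k i * a i + (\<Sum>l\<in>UNIV - {j} - {i}. k l * (c * a l))"
      using k False by (subst (asm) sum.remove[of _ i]) (auto simp: morales_def)
    also have "(\<Sum>l\<in>UNIV - {j} - {i}. k l * (c * a l)) = c * (\<Sum>l\<in>UNIV - {j} - {i}. k l * a l)"
      by (simp add: sum_distrib_left mult.left_commute)
    finally have eq: "c * a j = k i * a i + c * (\<Sum>l\<in>UNIV - {j} - {i}. k l * a l)" .
    then have "c dvd k i * a i" by (metis dvd_add_left_iff dvd_triv_left)
    then have "c dvd k i" using c(2) by (simp add: coprime_dvd_mult_left_iff)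
    then obtain x where x: "k i = c * x" by (elim dvdE)
    have "c * a j = c * (x * a i + (\<Sum>l\<in>UNIV - {j} - {i}. k l * a l))"
      using eq x by (simp add: algebra_simps)
    then have "a j = x * a i + (\<Sum>l\<in>UNIV - {j} - {i}. k l * a l)" using c(1) by simp
    also have "\<dots> = (\<Sum>l\<in>UNIV - {j}. (k(i := x)) l * a l)"
      using False by (subst (2) sum.remove[of _ i]) (auto intro!: sum.cong)
    finally show False using nonred[of j "k(i := x)"] by simp
  qed
qed


section \<open>Symbolic powers and height under Morales modifications\<close>

lemma symbolic_power_eq_morales_iff:
  fixes a :: "'n :: finite \<Rightarrow> nat"
  assumes a: "curve_exponents a" and c: "0 < c" "coprime c (a i)"
  defines "P \<equiv> defining_ideal a :: ('f :: field, 'n) mfps set"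
    and "P' \<equiv> defining_ideal (morales i c a) :: ('f, 'n) mfps set"
  shows "ideal_power ring_of_type_algebra P' n = symbolic_power ring_of_type_algebra P' n \<longleftrightarrow>
    ideal_power ring_of_type_algebra P n = symbolic_power ring_of_type_algebra P n"
proof -
  let ?R = "ring_of_type_algebra :: ('f, 'n) mfps ring"
  have pos: "0 < a j" for j using a by (simp add: curve_exponents_def)
  have a': "curve_exponents (morales i c a)" by (rule curve_exponents_morales[OF a c])
  then have pos': "0 < morales i c a j" for j by (simp add: curve_exponents_def)
  have prime: "primeideal P ?R" "primeideal P' ?R"
    unfolding P_def P'_def by (intro primeideal_defining_ideal pos pos')+
  have id': "ideal P' ?R" by (rule primeideal.axioms(1)[OF prime(2)])
  have iff: "f \<in> ideal_power ?R P' n \<longleftrightarrow> (\<forall>k<c. residue_part i c k f \<in> ideal_power ?R P n)" for f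
    unfolding P_def P'_def using ideal_power_morales_iff[of c a i f n] c pos by blast
  have dil: "dilate i c f \<in> ideal_power ?R P' n \<longleftrightarrow> f \<in> ideal_power ?R P n" for f
  proof -
    have "0 \<in> ideal_power ?R P n"
      by (intro ideal_zero ideal_ideal_power primeideal.axioms(1)[OF prime(1)])
    then show ?thesis
      unfolding iff using c(1) residue_part_dilate[OF c(1), of _ i f] by auto
  qed
  have "symbolic_power ?R P n \<subseteq> ideal_power ?R P n"
    if sub: "symbolic_power ?R P' n \<subseteq> ideal_power ?R P' n"
  proof
    fix f assume "f \<in> symbolic_power ?R P n"
    then obtain s where s: "s \<notin> P" "s * f \<in> ideal_power ?R P n"
      by (auto simp: symbolic_power_type)
    have "dilate i c s \<notin> P'"
      using s(1) unfolding P_def P'_def by (simp add: dilate_in_defining_ideal_iff c)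
    moreover have "dilate i c s * dilate i c f \<in> ideal_power ?R P' n"
      using s(2) dil[of "s * f"] by (simp add: dilate_mult c)
    ultimately have "dilate i c f \<in> symbolic_power ?R P' n"
      by (auto simp: symbolic_power_type)
    then show "f \<in> ideal_power ?R P n" using sub dil by blast
  qed
  moreover have "symbolic_power ?R P' n \<subseteq> ideal_power ?R P' n"
    if sub: "symbolic_power ?R P n \<subseteq> ideal_power ?R P n"
  proof
    fix f assume "f \<in> symbolic_power ?R P' n"
    then obtain s where s: "s \<notin> P'" "s * f \<in> ideal_power ?R P' n"
      by (auto simp: symbolic_power_type)
    obtain N where "\<And>n. N \<le> n \<Longrightarrow> \<exists>u. u * s - mfps_X i ^ n \<in> P'"
      using divides_X_power_mod_defining_ideal[of "morales i c a" s i] pos' a' s(1)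
      unfolding P'_def curve_exponents_def by blast
    \<comment> \<open>The exponent \<open>c * N\<close> is at least \<open>N\<close> and makes the
      power a dilate, namely of \<open>x_i ^ N\<close>. A dilated multiplier acts on each coordinate
      separately.\<close>
    then obtain u where u: "u * s - mfps_X i ^ (c * N) \<in> P'" using c(1) by fastforce
    let ?x = "u * s" and ?y = "mfps_X i ^ (c * N) :: ('f, 'n) mfps"
    text \<open>Expanding \<open>(?y - ?x) ^ n \<in> P' ^ n\<close> shows that \<open>?y ^ n\<close> lies in \<open>P' ^ n + (s)\<close>.\<close>
    have pow: "(?x - ?y) ^ n \<in> ideal_power ?R P' n" by (rule power_in_ideal_power[OF u])
    obtain v where v: "?x ^ 1 * v = (?y ^ n) - (?y - ?x) ^ n"
      using power_diff_sumr2[of ?y n "?y - ?x"] by auto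
    have "?y ^ n * f \<in> ideal_power ?R P' n"
    proof -
      have pid: "ideal (ideal_power ?R P' n) ?R" by (rule ideal_ideal_power[OF id'])
      have "?y ^ n * f = v * u * (s * f) + (- 1) ^ n * f * (?x - ?y) ^ n"
      proof -
        have neg: "(?y - ?x) ^ n = (- 1) ^ n * (?x - ?y) ^ n"
          by (metis minus_diff_eq power_minus)
        have "?y ^ n * f = (?x ^ 1 * v + (?y - ?x) ^ n) * f" unfolding v by simp
        then show ?thesis unfolding neg by (simp add: distrib_right distrib_left mult.assoc mult.commute mult.left_commute)
      qed
      also have "\<dots> \<in> ideal_power ?R P' n"
        by (rule ideal_add[OF pid ideal_mult_left[OF pid s(2)] ideal_mult_left[OF pid pow]])
      finally show ?thesis .
    qed
    also have "?y ^ n * f = dilate i c (mfps_X i ^ (N * n)) * f"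
      by (simp add: dilate_X_power c power_mult mult.assoc flip: power_mult)
    finally have "\<forall>k<c. mfps_X i ^ (N * n) * residue_part i c k f \<in> ideal_power ?R P n"
      unfolding iff by (simp add: residue_part_dilate_mult c)
    moreover have "mfps_X i ^ (N * n) \<notin> P"
      by (simp add: P_def defining_ideal_iff curve_hom_power curve_hom_X pos)
    ultimately have "\<forall>k<c. residue_part i c k f \<in> symbolic_power ?R P n"
      by (auto simp: symbolic_power_type)
    then show "f \<in> ideal_power ?R P' n" using sub iff by blast
  qed
  moreover have "ideal_power ?R P n \<subseteq> symbolic_power ?R P n" "ideal_power ?R P' n \<subseteq> symbolic_power ?R P' n"
    using prime by (auto simp: primeideal_type_iff intro!: ideal_power_subset_symbolic_power)
  ultimately show ?thesis by blast
qed

text \<open>The usual argument for going down along a flat extension. A prime that contains the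
  extension \<open>I\<close> of \<open>p0\<close> and avoids \<open>M\<close> contracts exactly to
  \<open>p0\<close> and lies inside \<open>q1\<close>.\<close>

lemma dilate_going_down:
  fixes p0 p1 q1 :: "('f :: field, 'n :: finite) mfps set"
  assumes c: "0 < c" and p0: "primeideal p0 ring_of_type_algebra"
    and q1: "primeideal q1 ring_of_type_algebra"
    and p1: "dilate i c -` q1 = p1" and sub: "p0 \<subseteq> p1"
  shows "\<exists>q0. primeideal q0 ring_of_type_algebra \<and> dilate i c -` q0 = p0 \<and> q0 \<subseteq> q1"
proof -
  have id0: "ideal p0 ring_of_type_algebra" by (rule primeideal.axioms(1)[OF p0])
  have id1: "ideal q1 ring_of_type_algebra" by (rule primeideal.axioms(1)[OF q1])
  have one: "1 \<notin> p0" "1 \<notin> q1" using p0 q1 by (auto simp: primeideal_type_iff)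
  define I where "I = {f. \<forall>k<c. residue_part i c k f \<in> p0}"
  define M where "M = {dilate i c s * r | s r. s \<notin> p0 \<and> r \<notin> q1}"
  have M: "dilate i c s * r \<in> M" if "s \<notin> p0" "r \<notin> q1" for s r
    using that by (auto simp: M_def)
  have "ideal I ring_of_type_algebra"
    unfolding ideal_type_iff
  proof (intro conjI ballI allI)
    show "0 \<in> I" by (simp add: I_def residue_part_0 ideal_zero[OF id0])
    show "f + g \<in> I" if "f \<in> I" "g \<in> I" for f g
      using that by (auto simp: I_def residue_part_add intro: ideal_add[OF id0])
    show "r * f \<in> I" if f: "f \<in> I" for f r
      unfolding I_def
    proof (intro CollectI allI impI)
      fix k assume k: "k < c"
      have "r * f = (\<Sum>l<c. dilate i c (residue_part i c l f) * (mfps_X i ^ l * r))"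
        by (subst residue_decomposition[OF c, of f i])
          (simp add: sum_distrib_left mult.assoc mult.left_commute mult.commute)
      then have "residue_part i c k (r * f) =
          (\<Sum>l<c. residue_part i c l f * residue_part i c k (mfps_X i ^ l * r))"
        by (simp add: residue_part_sum residue_part_dilate_mult c k)
      also have "\<dots> \<in> p0"
        using f by (intro ideal_sum[OF id0] ideal_mult_right[OF id0]) (auto simp: I_def)
      finally show "residue_part i c k (r * f) \<in> p0" .
    qed
  qed
  moreover have "1 \<in> M" using M[of 1 1] one by (simp add: dilate_1 c)
  moreover have "x * y \<in> M" if "x \<in> M" "y \<in> M" for x y
  proof -
    obtain s r s' r' where *: "x = dilate i c s * r" "y = dilate i c s' * r'"
      "s \<notin> p0" "r \<notin> q1" "s' \<notin> p0" "r' \<notin> q1"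
      using \<open>x \<in> M\<close> \<open>y \<in> M\<close> by (auto simp: M_def)
    then have "s * s' \<notin> p0" "r * r' \<notin> q1" using p0 q1 by (auto simp: primeideal_type_iff)
    then have "dilate i c (s * s') * (r * r') \<in> M" by (rule M)
    then show ?thesis by (simp add: * dilate_mult c mult.assoc mult.left_commute)
  qed
  moreover have "I \<inter> M = {}"
  proof (rule ccontr)
    assume "I \<inter> M \<noteq> {}"
    then obtain s r where *: "s \<notin> p0" "r \<notin> q1" "dilate i c s * r \<in> I" by (auto simp: M_def)
    \<comment> \<open>The coordinates of \<open>dilate i c s * r\<close> are \<open>s\<close> times
      those of \<open>r\<close>, and \<open>s\<close> is outside the prime \<open>p0\<close>. So
      \<open>r\<close> has coordinates in \<open>p0\<close>, hence in \<open>p1\<close>, which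
      forces \<open>r\<close> into \<open>q1\<close>.\<close>
    have "residue_part i c k r \<in> p0" if "k < c" for k
      using *(1,3) that p0 by (auto simp: I_def residue_part_dilate_mult c primeideal_type_iff)
    then have "dilate i c (residue_part i c k r) \<in> q1" if "k < c" for k
      using sub p1 that by blast
    then have "r \<in> q1"
      by (subst residue_decomposition[OF c, of r i])
        (auto intro!: ideal_sum[OF id1] ideal_mult_left[OF id1])
    then show False using * by simp
  qed
  ultimately obtain Q where Q: "primeideal Q ring_of_type_algebra" "I \<subseteq> Q" "Q \<inter> M = {}"
    using exists_primeideal_disjoint[of I M] by blast
  have "Q \<subseteq> q1"
  proof
    fix r assume "r \<in> Q"
    then show "r \<in> q1" using M[of 1 r] one Q(3) by (auto simp: dilate_1 c)
  qed
  moreover have "dilate i c -` Q = p0"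
  proof (intro equalityI subsetI)
    fix s assume "s \<in> dilate i c -` Q"
    then show "s \<in> p0" using M[of s 1] one Q(3) by auto
  next
    fix s assume "s \<in> p0"
    then have "dilate i c s \<in> I"
      using residue_part_dilate[OF c, of _ i s] ideal_zero[OF id0] by (auto simp: I_def)
    then show "s \<in> dilate i c -` Q" using Q(2) by auto
  qed
  ultimately show ?thesis using Q(1) by blast
qed

lemma ideal_height_morales_le:
  fixes a :: "'n :: finite \<Rightarrow> nat"
  assumes pos: "\<And>j. 0 < a j" and c: "0 < c" "coprime c (a i)"
  shows "ideal_height ring_of_type_algebra (defining_ideal a :: ('f :: field, 'n) mfps set) \<le>
    ideal_height ring_of_type_algebra (defining_ideal (morales i c a) :: ('f, 'n) mfps set)"
proof -
  let ?R = "ring_of_type_algebra :: ('f, 'n) mfps ring"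
  let ?P = "defining_ideal a :: ('f, 'n) mfps set"
  let ?P' = "defining_ideal (morales i c a) :: ('f, 'n) mfps set"
  have lift: "\<exists>q. (\<forall>i\<le>n. primeideal (q i) ?R) \<and> (\<forall>i<n. q i \<subset> q (Suc i)) \<and> q n = ?P'"
    if p: "\<forall>i\<le>n. primeideal (p i) ?R" "\<forall>i<n. p i \<subset> p (Suc i)" "p n = ?P" for n p
  proof -
    \<comment> \<open>The chain is lifted from its top downwards; \<open>k\<close> counts the steps
      below the index \<open>n\<close>.\<close>
    have "\<exists>q. (\<forall>j. n - k \<le> j \<and> j \<le> n \<longrightarrow> primeideal (q j) ?R \<and> dilate i c -` q j = p j) \<and>
        (\<forall>j. n - k \<le> j \<and> j < n \<longrightarrow> q j \<subseteq> q (Suc j)) \<and> q n = ?P'" if "k \<le> n" for k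
      using that
    proof (induction k)
      case 0
      have "primeideal ?P' ?R" by (intro primeideal_defining_ideal morales_pos c pos)
      moreover have "dilate i c -` ?P' = ?P"
        by (auto simp: dilate_in_defining_ideal_iff c)
      ultimately show ?case using p(3) by (intro exI[of _ "\<lambda>_. ?P'"]) auto
    next
      case (Suc k)
      then have "\<exists>q. (\<forall>j. n - k \<le> j \<and> j \<le> n \<longrightarrow> primeideal (q j) ?R \<and> dilate i c -` q j = p j) \<and>
          (\<forall>j. n - k \<le> j \<and> j < n \<longrightarrow> q j \<subseteq> q (Suc j)) \<and> q n = ?P'"
        by simp
      then obtain q where q: "\<And>j. n - k \<le> j \<Longrightarrow> j \<le> n \<Longrightarrow> primeideal (q j) ?R \<and> dilate i c -` q j = p j"
        "\<And>j. n - k \<le> j \<Longrightarrow> j < n \<Longrightarrow> q j \<subseteq> q (Suc j)" "q n = ?P'"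
        by (elim exE conjE) metis
      define l where "l = n - Suc k"
      have l: "Suc l = n - k" "l < n" using Suc.prems by (auto simp: l_def)
      have "p l \<subseteq> p (Suc l)" using p(2) l(2) by blast
      then obtain q0 where q0: "primeideal q0 ?R" "dilate i c -` q0 = p l" "q0 \<subseteq> q (Suc l)"
        using dilate_going_down[OF c(1), of "p l" "q (Suc l)" i "p (Suc l)"] p(1,2) q(1)[of "Suc l"] l
        by auto
      show ?case
      proof (intro exI[of _ "q(l := q0)"] conjI allI impI; (elim conjE)?)
        fix j assume j: "n - Suc k \<le> j" "j \<le> n"
        show "primeideal ((q(l := q0)) j) ?R" "dilate i c -` (q(l := q0)) j = p j"
          using q0 q(1)[of j] j l by (auto simp: l_def)
      next
        fix j assume j: "n - Suc k \<le> j" "j < n"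
        show "(q(l := q0)) j \<subseteq> (q(l := q0)) (Suc j)"
          using q0 q(2)[of j] j l by (auto simp: l_def)
      next
        show "(q(l := q0)) n = ?P'" using l q(3) by simp
      qed
    qed
    from this[OF order_refl] obtain q where q: "\<And>j. j \<le> n \<Longrightarrow> primeideal (q j) ?R \<and> dilate i c -` q j = p j"
      "\<And>j. j < n \<Longrightarrow> q j \<subseteq> q (Suc j)" "q n = ?P'"
      unfolding diff_self_eq_0 by (elim exE conjE) (metis le0)
    \<comment> \<open>The lifted inclusions are strict because the contractions differ.\<close>
    have "q j \<subset> q (Suc j)" if "j < n" for j
    proof -
      have "p j \<noteq> p (Suc j)" using p(2) that by blast
      moreover have "dilate i c -` q j = p j" "dilate i c -` q (Suc j) = p (Suc j)"
        using q(1)[of j] q(1)[of "Suc j"] that by simp_all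
      ultimately show ?thesis using q(2)[OF that] by fastforce
    qed
    then show ?thesis using q(1,3) by blast
  qed
  show ?thesis
    unfolding ideal_height_def
  proof (rule Sup_subset_mono, rule subsetI, elim CollectE exE conjE)
    fix x n p
    assume x: "x = enat n" and p: "\<forall>i\<le>n. primeideal (p i) ?R" "\<forall>i<n. p i \<subset> p (Suc i)" "p n = ?P"
    show "x \<in> {enat n |n. \<exists>p. (\<forall>i\<le>n. primeideal (p i) ?R) \<and> (\<forall>i<n. p i \<subset> p (Suc i)) \<and> p n = ?P'}"
      unfolding x using lift[OF p] by (intro CollectI exI[of _ n] conjI refl)
  qed
qed

lemma property_Q_morales:
  fixes a :: "'n :: finite \<Rightarrow> nat"
  assumes a: "curve_exponents a" and c: "0 < c" "coprime c (a i)" 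
    and Q: "property_Q TYPE('f :: field) a"
  shows "property_Q TYPE('f) (morales i c a)"
proof -
  have pos: "0 < a j" for j using a by (simp add: curve_exponents_def)
  show ?thesis
    using Q ideal_height_morales_le[of a c i, OF pos c, where 'f = 'f]
    unfolding property_Q_def Let_def mfps_ring_def symbolic_power_eq_morales_iff[OF a c]
    by (meson order.trans)
qed

section \<open>A lower bound for the height\<close>

definition mono_less :: "'n list \<Rightarrow> (('n \<Rightarrow> nat) \<times> ('n \<Rightarrow> nat)) set" where
  "mono_less xs = inv_image (lenlex less_than) (\<lambda>m. map m xs)"

lemma wf_mono_less: "wf (mono_less xs)"
  by (simp add: mono_less_def wf_lenlex)

lemma mono_less_total:
  assumes "set xs = UNIV" "u \<noteq> v"
  shows "(u, v) \<in> mono_less xs \<or> (v, u) \<in> mono_less xs"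
proof -
  have "map u xs \<noteq> map v xs" using assms by (auto simp: fun_eq_iff map_eq_conv)
  then show ?thesis
    using total_lenlex[OF total_less_than] by (auto simp: mono_less_def total_on_def)
qed

text \<open>\<open>lenlex\<close> compares lengths first, but all lists here are as long as
  \<open>xs\<close>. So this is the lexicographic order on exponent vectors, which is compatible
  with addition.\<close>

lemma mono_less_add:
  assumes "(u, v) \<in> mono_less xs"
  shows "((\<lambda>i. u i + w i), (\<lambda>i. v i + w i)) \<in> mono_less xs"
  using assms unfolding mono_less_def in_inv_image by (induction xs) (auto simp: Cons_lenlex_iff)

lemma mono_less_trans: "(u, v) \<in> mono_less xs \<Longrightarrow> (v, w) \<in> mono_less xs \<Longrightarrow> (u, w) \<in> mono_less xs"
  unfolding mono_less_def in_inv_image by (meson lenlex_trans trans_less_than transD)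

text \<open>The coefficient of \<open>f * g\<close> at the sum of the least exponents of
  \<open>f\<close> and \<open>g\<close> is a single product. Integrality is what makes kernels of
  maps between power series rings prime.\<close>

instance mfps :: (idom, finite) idom
proof
  fix f g :: "('a, 'b) mfps"
  assume fg: "f \<noteq> 0" "g \<noteq> 0"
  obtain xs :: "'b list" where xs: "set xs = UNIV" using finite_list[OF finite_UNIV] by blast
  have min: "\<exists>u. mfps_nth h u \<noteq> 0 \<and> (\<forall>v. (v, u) \<in> mono_less xs \<longrightarrow> mfps_nth h v = 0)"
    if "h \<noteq> 0" for h :: "('a, 'b) mfps"
  proof -
    have "\<exists>u. u \<in> {u. mfps_nth h u \<noteq> 0}"
      using that mfps_eqI[of h 0] by auto
    then obtain u where "u \<in> {u. mfps_nth h u \<noteq> 0}"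
      "\<And>v. (v, u) \<in> mono_less xs \<Longrightarrow> v \<notin> {u. mfps_nth h u \<noteq> 0}"
      using wf_mono_less[of xs] unfolding wf_eq_minimal by metis
    then show ?thesis by auto
  qed
  obtain u where u: "mfps_nth f u \<noteq> 0" "\<And>v. (v, u) \<in> mono_less xs \<Longrightarrow> mfps_nth f v = 0"
    using min[OF fg(1)] by blast
  obtain v where v: "mfps_nth g v \<noteq> 0" "\<And>w. (w, v) \<in> mono_less xs \<Longrightarrow> mfps_nth g w = 0"
    using min[OF fg(2)] by blast
  define m where "m = (\<lambda>i. u i + v i)"
  have irr: "(m, m) \<notin> mono_less xs" using wf_mono_less by (rule wf_not_refl)
  have vanish: "mfps_nth f u' * mfps_nth g v' = 0"
    if uv: "(u', v') \<in> mono_splits m" "(u', v') \<noteq> (u, v)" for u' v'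
  proof (rule ccontr)
    assume "mfps_nth f u' * mfps_nth g v' \<noteq> 0"
    \<comment> \<open>A nonvanishing term has both exponents at least the least ones. Were either
      strictly larger, adding up would put \<open>m\<close> strictly below itself.\<close>
    then have le: "u' = u \<or> (u, u') \<in> mono_less xs" "v' = v \<or> (v, v') \<in> mono_less xs"
      using u(2)[of u'] v(2)[of v'] mono_less_total[OF xs] by auto
    have m': "m = (\<lambda>i. u' i + v' i)" using uv(1) by (auto simp: mono_splits_def)
    have "m = (\<lambda>i. u i + v' i) \<or> (m, \<lambda>i. u i + v' i) \<in> mono_less xs"
      using le(2) mono_less_add[of v v' xs u] by (auto simp: m_def add.commute)
    moreover have "(\<lambda>i. u i + v' i) = m \<or> (\<lambda>i. u i + v' i, m) \<in> mono_less xs"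
      using le(1) mono_less_add[of u u' xs v'] by (auto simp: m')
    ultimately have "m = (\<lambda>i. u i + v' i)" using irr mono_less_trans by metis
    then have "v' = v" "u' = u"
      using m' by (auto simp: m_def fun_eq_iff)
    with uv(2) show False by simp
  qed
  have "mfps_nth (f * g) m = (\<Sum>(u', v') \<in> {(u, v)}. mfps_nth f u' * mfps_nth g v')"
    unfolding mfps_nth_mult
  proof (intro sum.mono_neutral_right finite_mono_splits ballI)
    show "{(u, v)} \<subseteq> mono_splits m" by (simp add: mono_splits_def m_def)
    show "(case p of (u', v') \<Rightarrow> mfps_nth f u' * mfps_nth g v') = 0" if "p \<in> mono_splits m - {(u, v)}" for p
      using vanish[of "fst p" "snd p"] that by (simp add: case_prod_unfold)
  qed
  then have "mfps_nth (f * g) m \<noteq> 0" using u(1) v(1) by simp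
  then show "f * g \<noteq> 0" by auto
qed

text \<open>The map induced by a map \<kappa> of exponent vectors. It is a ring homomorphism when
  \<kappa> is additive and has finite fibres.\<close>

definition push :: "(('n \<Rightarrow> nat) \<Rightarrow> ('k \<Rightarrow> nat)) \<Rightarrow> ('a :: comm_ring_1, 'n :: finite) mfps \<Rightarrow> ('a, 'k :: finite) mfps"
  where "push \<kappa> f = Abs_mfps (\<lambda>c. \<Sum>m | \<kappa> m = c. mfps_nth f m)"

lemma push_add: "push \<kappa> (f + g) = push \<kappa> f + push \<kappa> g"
  by (rule mfps_eqI) (simp add: push_def sum.distrib)

lemma push_diff: "push \<kappa> (f - g) = push \<kappa> f - push \<kappa> g"
  by (rule mfps_eqI) (simp add: push_def sum_subtractf)

lemma push_0: "push \<kappa> 0 = 0"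
  by (rule mfps_eqI) (simp add: push_def)

context
  fixes \<kappa> :: "('n :: finite \<Rightarrow> nat) \<Rightarrow> ('k :: finite \<Rightarrow> nat)"
  assumes fin: "\<And>c. finite {m. \<kappa> m = c}"
begin

lemma push_monom: "push \<kappa> (mfps_monom u) = mfps_monom (\<kappa> u)"
  using fin by (intro mfps_eqI) (auto simp: push_def sum.delta)

lemma push_mult:
  assumes add: "\<And>u v. \<kappa> (\<lambda>i. u i + v i) = (\<lambda>j. \<kappa> u j + \<kappa> v j)"
  shows "push \<kappa> (f * g) = push \<kappa> f * push \<kappa> g"
proof (rule mfps_eqI)
  fix c
  have "mfps_nth (push \<kappa> (f * g)) c =
      (\<Sum>(m, (u, v)) \<in> Sigma {m. \<kappa> m = c} mono_splits. mfps_nth f u * mfps_nth g v)"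
    unfolding push_def mfps_nth_mult mfps_nth_Abs by (subst sum.Sigma [symmetric]) (auto simp: fin)
  also have "\<dots> = (\<Sum>((p, q), (u, v)) \<in> Sigma (mono_splits c) (\<lambda>(p, q). {m. \<kappa> m = p} \<times> {m. \<kappa> m = q}).
      mfps_nth f u * mfps_nth g v)"
    by (rule sum.reindex_bij_witness
        [of _ "\<lambda>((p, q), (u, v)). ((\<lambda>i. u i + v i), (u, v))" "\<lambda>(m, (u, v)). ((\<kappa> u, \<kappa> v), (u, v))"])
      (auto simp: mono_splits_def add)
  also have "\<dots> = (\<Sum>(p, q) \<in> mono_splits c. \<Sum>(u, v) \<in> {m. \<kappa> m = p} \<times> {m. \<kappa> m = q}.
      mfps_nth f u * mfps_nth g v)"
    by (subst sum.Sigma [symmetric]) (auto simp: fin case_prod_unfold)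
  also have "\<dots> = mfps_nth (push \<kappa> f * push \<kappa> g) c"
    by (simp add: mfps_nth_mult push_def sum_product sum.cartesian_product)
  finally show "mfps_nth (push \<kappa> (f * g)) c = mfps_nth (push \<kappa> f * push \<kappa> g) c" .
qed

lemma primeideal_push_kernel:
  assumes add: "\<And>u v. \<kappa> (\<lambda>i. u i + v i) = (\<lambda>j. \<kappa> u j + \<kappa> v j)"
  shows "primeideal {f :: ('a :: idom, 'n) mfps. push \<kappa> f = 0} ring_of_type_algebra"
proof -
  have "\<kappa> (\<lambda>i. 0) = (\<lambda>j. 0)"
    using fun_cong[OF add[of "\<lambda>i. 0" "\<lambda>i. 0"]] by auto
  then have "push \<kappa> (1 :: ('a, 'n) mfps) = 1"
    using push_monom[of "\<lambda>i. 0", where 'a = 'a] by (simp add: mfps_monom_0)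
  then show ?thesis
    by (simp add: primeideal_type_iff ideal_type_iff push_add push_mult[OF add] push_0)
qed

end

text \<open>Vanishing for one grading passes to any finite union of its fibres. This compares
  successive kernels in the chain of primes and, in the cube case, the weight \<open>a\<close> with
  an auxiliary weight.\<close>

lemma sum_eq_0_union_of_fibres:
  assumes "finite A" "\<And>m m'. m \<in> A \<Longrightarrow> \<kappa> m' = \<kappa> m \<Longrightarrow> m' \<in> A"
    and "\<And>x. (\<Sum>m | \<kappa> m = x. f m) = (0 :: 'a :: comm_monoid_add)"
  shows "sum f A = 0"
proof -
  have "sum f A = (\<Sum>x\<in>\<kappa> ` A. \<Sum>m | m \<in> A \<and> \<kappa> m = x. f m)"
    by (rule sum.image_gen[OF assms(1)])
  also have "\<dots> = (\<Sum>x\<in>\<kappa> ` A. \<Sum>m | \<kappa> m = x. f m)"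
    by (intro sum.cong refl) (use assms(2) in auto)
  finally show ?thesis using assms(3) by simp
qed

text \<open>For \<open>i\<close> in \<open>S\<close>, the effect on exponents of substituting
  \<open>x_i ^ a l\<close> for \<open>x_l\<close> for all \<open>l\<close> in \<open>S\<close>, with
  \<open>x_i\<close> in the role of \<open>t\<close>. It interpolates between an injective map for
  \<open>S = {i}\<close> and the parametrisation of the curve for \<open>S = UNIV\<close>.\<close>

definition collapse :: "('n \<Rightarrow> nat) \<Rightarrow> 'n \<Rightarrow> 'n set \<Rightarrow> ('n \<Rightarrow> nat) \<Rightarrow> ('n \<Rightarrow> nat)" where
  "collapse a i S m =
     (\<lambda>j. if j = i then (\<Sum>l\<in>S. a l * m l) else if j \<in> S then 0 else m j)"

lemma collapse_add:
  "collapse a i S (\<lambda>i. u i + v i) = (\<lambda>j. collapse a i S u j + collapse a i S v j)"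
  by (auto simp: collapse_def algebra_simps sum.distrib)

lemma finite_collapse_fibre:
  fixes a :: "'n :: finite \<Rightarrow> nat"
  assumes pos: "\<And>i. 0 < a i" and i: "i \<in> S"
  shows "finite {m. collapse a i S m = c}"
proof -
  have "m j \<le> (\<Sum>j\<in>UNIV. c j)" if c: "collapse a i S m = c" for m j
  proof -
    have le: "c l \<le> (\<Sum>j\<in>UNIV. c j)" for l by (rule member_le_sum) auto
    show ?thesis
    proof (cases "j \<in> S")
      case True
      have "m j \<le> a j * m j" using pos[of j] by simp
      also have "\<dots> \<le> (\<Sum>l\<in>S. a l * m l)" by (rule member_le_sum) (use True in auto)
      also have "\<dots> = c i" by (simp add: collapse_def flip: c)
      finally show ?thesis using le[of i] by simp
    next
      case False
      then have "m j = c j" using i by (auto simp: collapse_def simp flip: c)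
      then show ?thesis using le[of j] by simp
    qed
  qed
  then have "{m. collapse a i S m = c} \<subseteq> {m. range m \<subseteq> {..\<Sum>j\<in>UNIV. c j}}" by auto
  moreover have "finite {m :: 'n \<Rightarrow> nat. range m \<subseteq> {..\<Sum>j\<in>UNIV. c j}}"
    using finite_set_of_finite_funs[of "UNIV :: 'n set" "{..\<Sum>j\<in>UNIV. c j}" 0]
    by (simp add: image_subset_iff)
  ultimately show ?thesis by (rule finite_subset)
qed

lemma collapse_kernel_mono:
  fixes a :: "'n :: finite \<Rightarrow> nat"
  assumes pos: "\<And>i. 0 < a i" and i: "i \<in> S" and ST: "S \<subseteq> T"
  shows "{f :: ('a :: comm_ring_1, 'n) mfps. push (collapse a i S) f = 0} \<subseteq> {f. push (collapse a i T) f = 0}"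
proof (intro subsetI CollectI mfps_eqI)
  fix f :: "('a, 'n) mfps" and c
  assume "f \<in> {f. push (collapse a i S) f = 0}"
  then have zero: "(\<Sum>m | collapse a i S m = x. mfps_nth f m) = 0" for x
    by (metis (mono_tags) mem_Collect_eq mfps_nth_Abs mfps_nth_ops(1) push_def)
  \<comment> \<open>Collapsing \<open>T\<close> factors through collapsing \<open>S\<close>. After
    the first collapse \<open>x_i\<close> already holds the weighted sum over \<open>S\<close>, so
    it enters the second one with weight \<open>1\<close>.\<close>
  have collapse_T: "collapse a i T m = collapse (\<lambda>j. if j \<in> S then 1 else a j) i (insert i (T - S)) (collapse a i S m)" for m
  proof
    fix j
    have "(\<Sum>l\<in>T. a l * m l) = (\<Sum>l\<in>S. a l * m l) + (\<Sum>l\<in>T - S. a l * m l)"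
      using ST by (metis add.commute finite sum.subset_diff)
    moreover have "(\<Sum>l\<in>T - S. (if l \<in> S then 1 else a l) * collapse a i S m l) = (\<Sum>l\<in>T - S. a l * m l)"
      using i by (intro sum.cong) (auto simp: collapse_def)
    ultimately show "collapse a i T m j =
        collapse (\<lambda>j. if j \<in> S then 1 else a j) i (insert i (T - S)) (collapse a i S m) j"
      using i ST by (auto simp: collapse_def)
  qed
  show "mfps_nth (push (collapse a i T) f) c = mfps_nth 0 c"
    unfolding push_def mfps_nth_Abs mfps_nth_ops
  proof (rule sum_eq_0_union_of_fibres[OF finite_collapse_fibre[OF pos] _ zero])
    show "i \<in> T" using i ST by blast
    show "m' \<in> {m. collapse a i T m = c}"
      if "m \<in> {m. collapse a i T m = c}" "collapse a i S m' = collapse a i S m" for m m'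
      using that collapse_T by simp
  qed
qed

lemma collapse_kernel_strict:
  fixes a :: "'n :: finite \<Rightarrow> nat"
  assumes pos: "\<And>i. 0 < a i" and i: "i \<in> S" and j: "j \<in> T" "j \<notin> S" and ST: "S \<subseteq> T"
  shows "{f :: ('a :: comm_ring_1, 'n) mfps. push (collapse a i S) f = 0} \<noteq> {f. push (collapse a i T) f = 0}"
proof -
  \<comment> \<open>The binomial \<open>x_i ^ a j - x_j ^ a i\<close> separates the kernels: both
    terms have weight \<open>a i * a j\<close> once \<open>j\<close> is collapsed, but differ in
    \<open>x_j\<close> before.\<close>
  define u where "u = (\<lambda>l. if l = i then a j else 0)"
  define v where "v = (\<lambda>l. if l = j then a i else 0)"
  have ij: "i \<noteq> j" using i j by auto
  have iT: "i \<in> T" using i ST by blast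
  have "(\<Sum>l\<in>T. a l * u l) = (\<Sum>l\<in>T. if l = i then a i * a j else 0)"
    by (rule sum.cong) (auto simp: u_def)
  also have "\<dots> = (\<Sum>l\<in>T. if l = j then a j * a i else 0)"
    using iT j(1) by (simp add: sum.delta)
  also have "\<dots> = (\<Sum>l\<in>T. a l * v l)"
    by (rule sum.cong) (auto simp: v_def)
  finally have "collapse a i T u = collapse a i T v"
    using iT j(1) by (auto simp: collapse_def fun_eq_iff) (auto simp: u_def v_def)
  moreover have "collapse a i S u j \<noteq> collapse a i S v j"
    using i j ij pos[of i] by (simp add: collapse_def u_def v_def)
  then have "collapse a i S u \<noteq> collapse a i S v" by auto
  ultimately have "push (collapse a i T) (mfps_monom u - mfps_monom v :: ('a, 'n) mfps) = 0"
    "mfps_nth (push (collapse a i S) (mfps_monom u - mfps_monom v :: ('a, 'n) mfps)) (collapse a i S u) \<noteq> 0"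
    by (simp_all add: push_diff push_monom finite_collapse_fibre pos i iT)
  then show ?thesis by (metis (mono_tags, lifting) mem_Collect_eq mfps_nth_ops(1))
qed

lemma collapse_UNIV_kernel:
  fixes a :: "'n :: finite \<Rightarrow> nat"
  shows "{f :: ('a :: field, 'n) mfps. push (collapse a i UNIV) f = 0} = defining_ideal a"
proof -
  have eq: "collapse a i UNIV m = c \<longleftrightarrow> c = (\<lambda>j. if j = i then weight a m else 0)" for m c
    by (auto simp: collapse_def weight_def)
  have nth: "mfps_nth (push (collapse a i UNIV) f) (\<lambda>j. if j = i then k else 0) = fps_nth (curve_hom a f) k"
    for k and f :: "('a, 'n) mfps"
    unfolding fps_nth_curve_hom push_def mfps_nth_Abs eq
    by (intro sum.cong) (auto simp: fun_eq_iff)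
  have "push (collapse a i UNIV) f = 0 \<longleftrightarrow> curve_hom a f = 0" for f :: "('a, 'n) mfps"
  proof
    assume "push (collapse a i UNIV) f = 0"
    then show "curve_hom a f = 0" by (simp add: fps_eq_iff flip: nth)
  next
    assume h: "curve_hom a f = 0"
    show "push (collapse a i UNIV) f = 0"
    proof (rule mfps_eqI)
      fix c
      show "mfps_nth (push (collapse a i UNIV) f) c = mfps_nth 0 c"
      proof (cases "\<exists>k. c = (\<lambda>j. if j = i then k else 0)")
        case True
        then obtain k where k: "c = (\<lambda>j. if j = i then k else 0)" by blast
        show ?thesis unfolding k nth by (simp add: h)
      next
        case False
        then have "{m. collapse a i UNIV m = c} = {}" unfolding eq by blast
        then show ?thesis unfolding push_def mfps_nth_Abs by (simp only: sum.empty mfps_nth_ops)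
      qed
    qed
  qed
  then show ?thesis by (simp only: set_eq_iff mem_Collect_eq defining_ideal_iff simp_thms)
qed

lemma height_defining_ideal_ge:
  fixes a :: "'n :: finite \<Rightarrow> nat"
  assumes pos: "\<And>i. 0 < a i"
  shows "enat (card (UNIV :: 'n set) - 1) \<le>
    ideal_height ring_of_type_algebra (defining_ideal a :: ('f :: field, 'n) mfps set)"
proof -
  obtain h where h: "bij_betw h {0..<card (UNIV :: 'n set)} (UNIV :: 'n set)"
    using ex_bij_betw_nat_finite[of "UNIV :: 'n set"] by auto
  have inj: "h k = h l \<longleftrightarrow> k = l" if "k < card (UNIV :: 'n set)" "l < card (UNIV :: 'n set)" for k l
    using h that by (auto simp: bij_betw_def inj_on_def)
  \<comment> \<open>Collapsing one more variable at a time gives primes with indices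
    \<open>0\<close> to \<open>d - 1\<close>. The last of them is the defining ideal.\<close>
  define S where "S k = h ` {..k}" for k
  define p where "p k = {f :: ('f, 'n) mfps. push (collapse a (h 0) (S k)) f = 0}" for k
  have S0: "h 0 \<in> S k" for k by (auto simp: S_def)
  have "p k \<subset> p (Suc k)" if k: "k < card (UNIV :: 'n set) - 1" for k
  proof -
    have sub: "S k \<subseteq> S (Suc k)" by (auto simp: S_def)
    have "h (Suc k) \<in> S (Suc k)" by (simp add: S_def)
    moreover have "h (Suc k) \<notin> S k" using k by (auto simp: S_def inj)
    ultimately show ?thesis
      unfolding p_def psubset_eq
      by (intro conjI collapse_kernel_mono collapse_kernel_strict[where j = "h (Suc k)"] pos S0 sub)
  qed
  moreover have "primeideal (p k) ring_of_type_algebra" for k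
    unfolding p_def by (intro primeideal_push_kernel finite_collapse_fibre pos S0 collapse_add)
  moreover have "S (card (UNIV :: 'n set) - 1) = UNIV"
  proof -
    have "{..card (UNIV :: 'n set) - 1} = {0..<card (UNIV :: 'n set)}" using finite_UNIV_card_ge_0[where 'a = 'n] by auto
    then show ?thesis using h by (simp add: S_def bij_betw_def)
  qed
  then have "p (card (UNIV :: 'n set) - 1) = defining_ideal a" unfolding p_def by (simp add: collapse_UNIV_kernel)
  ultimately show ?thesis
    unfolding ideal_height_def by (intro Sup_upper CollectI exI[of _ "card (UNIV :: 'n set) - 1"]
        exI[of _ p] conjI allI impI refl) simp_all
qed

section \<open>Curves whose powers and symbolic powers differ early\<close>

lemma property_Q_if_power_ne_symbolic_power:
  fixes a :: "'n :: finite \<Rightarrow> nat"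
  assumes pos: "\<And>i. 0 < a i" and n: "1 \<le> n" "n < card (UNIV :: 'n set)"
    and ex: "\<exists>w. w \<in> symbolic_power ring_of_type_algebra (defining_ideal a) n \<and>
      w \<notin> ideal_power ring_of_type_algebra (defining_ideal a :: ('f :: field, 'n) mfps set) n"
  shows "property_Q TYPE('f) a"
proof -
  have "enat n \<le> enat (card (UNIV :: 'n set) - 1)" using n by simp
  also have "\<dots> \<le> ideal_height ring_of_type_algebra (defining_ideal a :: ('f, 'n) mfps set)"
    by (rule height_defining_ideal_ge[OF pos])
  finally show ?thesis
    using n(1) ex unfolding property_Q_def Let_def mfps_ring_def by blast
qed

lemma sum_delta_mult:
  fixes f :: "'n :: finite \<Rightarrow> nat"
  shows "(\<Sum>j\<in>UNIV. f j * (if j = i then k else 0)) = f i * k"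
  by (simp add: if_distrib cong: if_cong)

lemma weight_single: "weight a (\<lambda>j. if j = i then k else 0) = a i * k"
  unfolding weight_def by (rule sum_delta_mult)

lemma mfps_nth_X_mult:
  "mfps_nth (mfps_X i * f) m = (if m i = 0 then 0 else mfps_nth f (m(i := m i - 1)))"
  using mfps_nth_X_power_mult[of i 1 f m] by auto

lemma ideal_power_1_subset:
  fixes I :: "'a :: comm_ring_1 set"
  assumes I: "ideal I ring_of_type_algebra" and x: "x \<in> ideal_power ring_of_type_algebra I (Suc 0)"
  shows "x \<in> I"
  using x by (induction rule: ideal_power_Suc_induct) (auto intro: ideal_mult_left[OF I] ideal_add[OF I])

text \<open>
  The witness below is \<open>X\<^sub>4 ^ k\<close> times the determinant of the Hankel matrix with rows
  \<open>(X\<^sub>1, X\<^sub>2, X\<^sub>3)\<close>, \<open>(X\<^sub>2, X\<^sub>3, X\<^sub>4)\<close>, \<open>(X\<^sub>3, X\<^sub>4, X\<^sub>5)\<close>, where \<open>X\<^sub>5 = G / X\<^sub>4 ^ k\<close>.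
  All its 2-minors lie in the localised ideal, and \<open>X\<^sub>1\<close> times the determinant
  is a quadratic expression in them.
\<close>

lemma symbolic_square_ne_square:
  fixes a :: "'n :: finite \<Rightarrow> nat" and i1 i2 i3 i4 :: 'n and k :: nat
  assumes pos: "\<And>i. 0 < a i"
    and dist: "distinct [i1, i2, i3, i4]"
    and arith: "a i1 + a i3 = 2 * a i2" "a i2 + a i4 = 2 * a i3"
    and g: "weight a g + a i3 = (k + 2) * a i4"
    and uniq: "\<And>u m. u i3 \<le> 1 \<Longrightarrow> u i4 \<le> k \<Longrightarrow> (\<And>j. j \<noteq> i3 \<Longrightarrow> j \<noteq> i4 \<Longrightarrow> u j = 0) \<Longrightarrow>
      weight a m = weight a u \<Longrightarrow> m = u"
  shows "\<exists>w. w \<in> symbolic_power ring_of_type_algebra (defining_ideal a) 2 \<and>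
    w \<notin> ideal_power ring_of_type_algebra (defining_ideal a :: ('f :: field, 'n) mfps set) 2"
proof -
  let ?R = "ring_of_type_algebra :: ('f, 'n) mfps ring"
  define P where "P = (defining_ideal a :: ('f, 'n) mfps set)"
  have id: "ideal P ?R" unfolding P_def by (rule ideal_defining_ideal[OF pos])
  define X1 X2 X3 X4 G Y where "X1 = (mfps_X i1 :: ('f, 'n) mfps)" and "X2 = (mfps_X i2 :: ('f, 'n) mfps)"
    and "X3 = (mfps_X i3 :: ('f, 'n) mfps)" and "X4 = (mfps_X i4 :: ('f, 'n) mfps)"
    and "G = (mfps_monom g :: ('f, 'n) mfps)" and "Y = X4 ^ k"
  note defs = X1_def X2_def X3_def X4_def G_def Y_def
  note hom = defining_ideal_iff curve_hom_diff curve_hom_mult curve_hom_X curve_hom_power curve_hom_monom pos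
  have D12: "X1 * X3 - X2 * X2 \<in> P"
    using arith by (simp add: P_def defs hom mult_2 flip: power_add)
  have D13: "X1 * X4 - X2 * X3 \<in> P"
    using arith by (simp add: P_def defs hom flip: power_add)
  \<comment> \<open>This is the weight identity behind \<open>X1 * X5 - X3 * X3\<close>, cleared of
    the denominator \<open>Y\<close>.\<close>
  have "k * a i4 + (a i3 + a i3) = a i1 + weight a g" using arith g by (simp add: algebra_simps)
  then have E: "X1 * G - Y * (X3 * X3) \<in> P"
    by (simp add: P_def defs hom mult.commute flip: power_add power_mult)
  define w where "w = X1 * (G * X3 - Y * X4 * X4) + X2 * (2 * Y * X3 * X4 - G * X2) - Y * X3 ^ 3"
  \<comment> \<open>The Desnanot-Jacobi identity for the Hankel determinant with respect to its
    entry \<open>X1\<close>, multiplied by \<open>Y\<close>.\<close>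
  have "X1 * w = (X1 * X3 - X2 * X2) * (X1 * G - Y * (X3 * X3))
      - Y * ((X1 * X4 - X2 * X3) * (X1 * X4 - X2 * X3))"
    unfolding w_def by (simp add: algebra_simps power3_eq_cube)
  also have "\<dots> \<in> ideal_power ?R P 2"
    by (intro ideal_diff ideal_mult_left ideal_ideal_power[OF id] ideal_power_2I D12 D13 E)
  finally have "w \<in> symbolic_power ?R P 2"
    using mfps_X_notin_defining_ideal[of a i1] pos by (auto simp: symbolic_power_type P_def X1_def)
  moreover have "w \<notin> ideal_power ?R P 2"
  proof
    \<comment> \<open>The exponent of \<open>Y * X3 ^ 3\<close>, the only term in the definition of
      \<open>w\<close> without a factor \<open>X1\<close> or \<open>X2\<close>.\<close>
    define n where "n = (\<lambda>j. if j = i3 then 3 else if j = i4 then k else 0)"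
    have dist': "i1 \<noteq> i3" "i1 \<noteq> i4" "i2 \<noteq> i3" "i2 \<noteq> i4" "i3 \<noteq> i4" using dist by auto
    \<comment> \<open>By \<open>uniq\<close> the monomial \<open>u\<close> is alone in its weight,
      so its coefficient is a full coefficient of the image in \<open>t\<close>, which is zero on
      \<open>P\<close>.\<close>
    have vanish: "mfps_nth f u = 0" if f: "f \<in> P" and u: "u i3 \<le> 1" "\<And>j. u j \<le> n j" for f u
    proof -
      have "u i4 \<le> k" using u(2)[of i4] dist' by (simp add: n_def)
      moreover have "u j = 0" if "j \<noteq> i3" "j \<noteq> i4" for j using u(2)[of j] that by (simp add: n_def)
      ultimately have "{m. weight a m = weight a u} = {u}" using uniq[of u] u(1) by auto
      then have "mfps_nth f u = fps_nth (curve_hom a f) (weight a u)" by (simp add: fps_nth_curve_hom)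
      then show ?thesis using f by (simp add: P_def defining_ideal_iff)
    qed
    assume "w \<in> ideal_power ?R P 2"
    then have "w \<in> ideal_power ?R P (Suc (Suc 0))" by (simp only: numeral_2_eq_2)
    then have "mfps_nth w n = 0"
    proof (induction rule: ideal_power_Suc_induct)
      case (mult f h)
      then have "f \<in> P" by (intro ideal_power_1_subset[OF id])
      have "mfps_nth f u * mfps_nth h v = 0" if uv: "(u, v) \<in> mono_splits n" for u v
      proof -
        have s: "u j + v j = n j" for j using uv by (auto simp: mono_splits_def)
        \<comment> \<open>An exponent \<open>3\<close> cannot split into two parts that are both at
          least \<open>2\<close>; the factor with the smaller part vanishes there.\<close>
        have "u i3 \<le> 1 \<or> v i3 \<le> 1" using s[of i3] by (simp add: n_def) linarith
        moreover have "u j \<le> n j" "v j \<le> n j" for j using s[of j] by simp_all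
        ultimately show ?thesis using vanish[OF \<open>f \<in> P\<close>, of u] vanish[OF mult(2), of v] by auto
      qed
      then show ?case unfolding mfps_nth_mult by (intro sum.neutral) auto
    qed simp
    moreover have "mfps_nth w n = - 1"
    proof -
      have "mfps_nth (Y * X3 ^ 3) n = 1"
        unfolding defs mfps_nth_X_power_mult mfps_X_power[of i3] using dist'
        by (auto simp: n_def fun_eq_iff)
      moreover have "mfps_nth (X1 * f) n = 0" "mfps_nth (X2 * f) n = 0" for f
        using dist' by (simp_all add: X1_def X2_def mfps_nth_X_mult n_def)
      ultimately show ?thesis unfolding w_def by simp
    qed
    ultimately show False by simp
  qed
  ultimately show ?thesis unfolding P_def by blast
qed

lemma property_Q_arithmetic_subseq_five:
  fixes a :: "'n :: finite \<Rightarrow> nat"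
  assumes a: "curve_exponents a" and five: "arithmetic_subseq_five a"
  shows "property_Q TYPE('f :: field) a"
proof -
  have pos: "0 < a i" for i using a by (simp add: curve_exponents_def)
  have nonred: "a j \<noteq> (\<Sum>l\<in>UNIV - {j}. k l * a l)" for j k
    using a by (auto simp: curve_exponents_def)
  obtain b r where sub: "subseq [b, b + r, b + 2 * r, b + 3 * r, b + 4 * r] (sorted_list_of_set (range a))"
    using five by (auto simp: arithmetic_subseq_five_def)
  then obtain N where nths: "[b, b + r, b + 2 * r, b + 3 * r, b + 4 * r] = nths (sorted_list_of_set (range a)) N"
    by (auto simp: subseq_conv_nths)
  have "distinct [b, b + r, b + 2 * r, b + 3 * r, b + 4 * r]"
    unfolding nths by (rule distinct_nthsI) simp
  then have r: "0 < r" by auto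
  have "set [b, b + r, b + 2 * r, b + 3 * r, b + 4 * r] \<subseteq> range a"
    unfolding nths using set_nths_subset[of "sorted_list_of_set (range a)" N] by simp
  then obtain i1 i2 i3 i4 i5 where i: "a i1 = b" "a i2 = b + r" "a i3 = b + 2 * r" "a i4 = b + 3 * r"
    "a i5 = b + 4 * r" by (auto simp: image_iff)
  have dist: "distinct [i1, i2, i3, i4]" using i r by auto
  have "card {i1, i2, i3, i4} \<le> card (UNIV :: 'n set)" by (rule card_mono) auto
  then have card: "2 < card (UNIV :: 'n set)" using dist by simp
  \<comment> \<open>With five terms \<open>X5\<close> is itself a variable, so \<open>k = 0\<close>.
    The uniqueness condition then concerns only \<open>1\<close> and \<open>x_i3\<close>, where it
    follows from non-redundancy.\<close>
  have "\<exists>w. w \<in> symbolic_power ring_of_type_algebra (defining_ideal a) 2 \<and>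
      w \<notin> ideal_power ring_of_type_algebra (defining_ideal a :: ('f, 'n) mfps set) 2"
  proof (rule symbolic_square_ne_square[OF pos dist, where k = 0 and g = "\<lambda>j. if j = i5 then 1 else 0"])
    show "a i1 + a i3 = 2 * a i2" "a i2 + a i4 = 2 * a i3" using i by simp_all
    show "weight a (\<lambda>j. if j = i5 then 1 else 0) + a i3 = (0 + 2) * a i4"
      unfolding weight_single using i by simp
    fix u m
    assume u: "u i3 \<le> (1 :: nat)" "u i4 \<le> (0 :: nat)" "\<And>j. j \<noteq> i3 \<Longrightarrow> j \<noteq> i4 \<Longrightarrow> u j = 0"
      and eq: "weight a m = weight a u"
    have u_eq: "u = (\<lambda>j. if j = i3 then u i3 else 0)" using u(2,3) by (auto simp: fun_eq_iff)
    have wu: "weight a u = a i3 * u i3" by (subst u_eq) (rule weight_single)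
    have wm: "weight a m = a i3 * m i3 + (\<Sum>j\<in>UNIV - {i3}. a j * m j)" by (rule weight_remove)
    have "m i3 = u i3"
    proof (rule ccontr)
      assume ne: "m i3 \<noteq> u i3"
      have "a i3 * m i3 \<le> a i3 * u i3" using wm wu eq by linarith
      then have "m i3 < u i3" using ne pos[of i3] by simp
      then have "u i3 = 1" "m i3 = 0" using u(1) by auto
      then have "a i3 = (\<Sum>j\<in>UNIV - {i3}. m j * a j)"
        using wm wu eq by (simp add: mult.commute)
      then show False using nonred by blast
    qed
    moreover from this have "(\<Sum>j\<in>UNIV - {i3}. a j * m j) = 0" using wm wu eq by simp
    then have "\<forall>j\<in>UNIV - {i3}. a j * m j = 0" by (subst (asm) sum_eq_0_iff) auto
    then have "m j = 0" if "j \<noteq> i3" for j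
      using that pos[of j] by (metis DiffI UNIV_I less_irrefl mult_is_0 singletonD)
    ultimately show "m = u" by (subst u_eq) (auto simp: fun_eq_iff)
  qed
  from property_Q_if_power_ne_symbolic_power[OF pos _ card this] show ?thesis by simp
qed

text \<open>Orders of vanishing add under products. The weight \<open>b\<close> need not be the one
  defining \<open>I\<close>, which makes this a test for non-membership in a power.\<close>

lemma curve_hom_ideal_power_order:
  fixes b :: "'n :: finite \<Rightarrow> nat" and I :: "('f :: field, 'n) mfps set"
  assumes b: "\<And>i. 0 < b i" and I: "\<And>f l. f \<in> I \<Longrightarrow> l < s \<Longrightarrow> fps_nth (curve_hom b f) l = 0"
    and f: "f \<in> ideal_power ring_of_type_algebra I n" and l: "l < n * s"
  shows "fps_nth (curve_hom b f) l = 0"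
  using f l
proof (induction n arbitrary: f l)
  case (Suc n)
  show ?case using Suc.prems
  proof (induction arbitrary: l rule: ideal_power_Suc_induct)
    case (mult u v)
    have "fps_nth (curve_hom b u) i * fps_nth (curve_hom b v) (l - i) = 0" if "i \<le> l" for i
    proof (cases "i < n * s")
      case True
      then show ?thesis using Suc.IH[OF mult(1)] by simp
    next
      case False
      then have "l - i < s" using mult(3) that by simp
      then show ?thesis using I[OF mult(2)] by simp
    qed
    then show ?case
      unfolding curve_hom_mult[OF b] fps_mult_nth by (intro sum.neutral) auto
  next
    case (add u v)
    then show ?case by (simp add: curve_hom_add)
  qed
qed simp

text \<open>Here \<open>n\<close> is the degree of a monomial and \<kappa> its index sum, at most
  three times the degree. By coprimality any other solution is \<open>n - r * l\<close> and
  \<open>\<kappa> + b * l\<close>. A negative \<open>l\<close> contradicts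
  \<open>\<kappa> < b\<close>; a positive one raises the index sum and lowers the degree, breaking
  \<open>\<kappa>' \<le> 3 * n'\<close>.\<close>

lemma arithmetic_weight_unique:
  fixes b r n \<kappa> n' \<kappa>' :: nat
  assumes "coprime b r" "0 < b" "0 < r" and eq: "n' * b + \<kappa>' * r = n * b + \<kappa> * r"
    and "\<kappa> < b" "3 * n \<le> \<kappa> + 2" "\<kappa>' \<le> 3 * n'"
  shows "n' = n \<and> \<kappa>' = \<kappa>"
proof -
  have "int (n' * b + \<kappa>' * r) = int (n * b + \<kappa> * r)" using eq by (simp only:)
  then have eq': "int r * (int \<kappa>' - int \<kappa>) = int b * (int n - int n')"
    by (simp add: algebra_simps)
  then have "int b dvd int r * (int \<kappa>' - int \<kappa>)" by simp
  moreover have "coprime (int b) (int r)" using assms(1) by simp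
  ultimately have "int b dvd int \<kappa>' - int \<kappa>"
    using coprime_dvd_mult_right_iff by blast
  then obtain l where l: "int \<kappa>' - int \<kappa> = int b * l" by (elim dvdE)
  have "int b * (int r * l) = int b * (int n - int n')"
    using eq' l by (simp add: algebra_simps)
  then have n: "int r * l = int n - int n'" using assms(2) by simp
  have "l = 0"
  proof (rule ccontr)
    assume "l \<noteq> 0"
    then consider "l \<le> - 1" | "l \<ge> 1" by linarith
    then show False
    proof cases
      case 1
      then have "int b * l \<le> int b * (- 1)" by (intro mult_left_mono) auto
      then show False using l assms(5) by simp
    next
      case 2
      then have "int b * 1 \<le> int b * l" "int r * 1 \<le> int r * l" by (intro mult_left_mono; simp)+
      then show False using l n assms by linarith
    qed
  qed
  then show ?thesis using l n by simp
qed

section \<open>Four exponents in arithmetic progression\<close>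

context
  fixes a :: "'n :: finite \<Rightarrow> nat" and i1 i2 i3 i4 :: 'n and b r :: nat
  assumes UNIV_eq: "(UNIV :: 'n set) = {i1, i2, i3, i4}"
    and dist: "distinct [i1, i2, i3, i4]"
    and ai: "a i1 = b" "a i2 = b + r" "a i3 = b + 2 * r" "a i4 = b + 3 * r"
    and b: "0 < b" and r: "0 < r" and coprime: "coprime b r"
begin

lemma weight_four:
  fixes e :: "'n \<Rightarrow> nat"
  shows "weight e m = e i1 * m i1 + e i2 * m i2 + e i3 * m i3 + e i4 * m i4"
  unfolding weight_def UNIV_eq using dist by simp

lemma pos_four: "0 < a i"
proof -
  have "i \<in> {i1, i2, i3, i4}" using UNIV_eq by auto
  then show ?thesis using ai b by auto
qed

lemma eq_four: "(\<And>j. j \<in> {i1, i2, i3, i4} \<Longrightarrow> m j = u j) \<Longrightarrow> m = (u :: 'n \<Rightarrow> nat)"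
  using UNIV_eq by (auto simp: fun_eq_iff)

lemma weight_arithmetic:
  "weight a m = (m i1 + m i2 + m i3 + m i4) * b + (m i2 + 2 * m i3 + 3 * m i4) * r"
  by (simp add: weight_four ai algebra_simps)

text \<open>The quantity \<open>3 * u i1 + 2 * u i2 + u i3\<close> is three times the degree minus
  the index sum, so the last assumption says that \<open>u\<close> has nearly maximal index sum for
  its degree.\<close>

lemma arithmetic_four_unique:
  assumes "weight a m = weight a u" "u i2 + 2 * u i3 + 3 * u i4 < b"
    and "3 * u i1 + 2 * u i2 + u i3 \<le> 2"
  shows "m i1 + m i2 + m i3 + m i4 = u i1 + u i2 + u i3 + u i4"
    and "m i2 + 2 * m i3 + 3 * m i4 = u i2 + 2 * u i3 + 3 * u i4"
proof -
  have "3 * (u i1 + u i2 + u i3 + u i4) \<le> u i2 + 2 * u i3 + 3 * u i4 + 2"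
    using assms(3) by simp
  moreover have "m i2 + 2 * m i3 + 3 * m i4 \<le> 3 * (m i1 + m i2 + m i3 + m i4)" by simp
  ultimately have "m i1 + m i2 + m i3 + m i4 = u i1 + u i2 + u i3 + u i4 \<and>
      m i2 + 2 * m i3 + 3 * m i4 = u i2 + 2 * u i3 + 3 * u i4"
    by (rule arithmetic_weight_unique[OF coprime b r assms(1)[unfolded weight_arithmetic] assms(2)])
  then show "m i1 + m i2 + m i3 + m i4 = u i1 + u i2 + u i3 + u i4"
    and "m i2 + 2 * m i3 + 3 * m i4 = u i2 + 2 * u i3 + 3 * u i4"
    by blast+
qed

lemma symbolic_square_four:
  assumes g: "weight a g + a i3 = (k + 2) * a i4" and k: "3 * k + 2 < b"
  shows "\<exists>w. w \<in> symbolic_power ring_of_type_algebra (defining_ideal a) 2 \<and>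
    w \<notin> ideal_power ring_of_type_algebra (defining_ideal a :: ('f :: field, 'n) mfps set) 2"
proof (rule symbolic_square_ne_square[OF pos_four dist _ _ g])
  show "a i1 + a i3 = 2 * a i2" "a i2 + a i4 = 2 * a i3" using ai by simp_all
  fix u m
  assume u: "u i3 \<le> (1 :: nat)" "u i4 \<le> k" "\<And>j. j \<noteq> i3 \<Longrightarrow> j \<noteq> i4 \<Longrightarrow> u j = 0"
    and eq: "weight a m = weight a u"
  have u12: "u i1 = 0" "u i2 = 0" using u(3) dist by auto
  have same: "m i1 + m i2 + m i3 + m i4 = u i1 + u i2 + u i3 + u i4"
    "m i2 + 2 * m i3 + 3 * m i4 = u i2 + 2 * u i3 + 3 * u i4"
    using arithmetic_four_unique[OF eq] u(1,2) u12 k by linarith+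
  \<comment> \<open>Three times the first equation minus the second gives
    \<open>3 * m i1 + 2 * m i2 + m i3 = u i3\<close>, which is at most \<open>1\<close>.\<close>
  have "m i1 = 0" "m i2 = 0" using same u(1) u12 by linarith+
  moreover from this have "m i3 = u i3" "m i4 = u i4" using same u12 by linarith+
  ultimately show "m = u" using u12 by (intro eq_four) auto
qed

text \<open>
  The remaining case: here the ideal is generated by the five Pfaffians
  \<open>D12, D13, D23, h1, h2\<close>, and its square is symbolic.  The extra weights used to detect that
  \<open>w\<close> is not in the cube are \<open>3 q, 2 q + 1, q + 2, 3\<close>, which form an arithmetic progression
  and so kill the three minors, except that the first is replaced by a large number.
\<close>

lemma symbolic_cube_four:
  assumes bq: "b = 3 * q + 2" and q: "1 \<le> q"
  shows "\<exists>w. w \<in> symbolic_power ring_of_type_algebra (defining_ideal a) 3 \<and>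
    w \<notin> ideal_power ring_of_type_algebra (defining_ideal a :: ('f :: field, 'n) mfps set) 3"
proof -
  let ?R = "ring_of_type_algebra :: ('f, 'n) mfps ring"
  define P where "P = (defining_ideal a :: ('f, 'n) mfps set)"
  have id: "ideal P ?R" unfolding P_def by (rule ideal_defining_ideal[OF pos_four])
  obtain p where p: "q = Suc p" using q by (cases q) auto
  define X1 X2 X3 X4 Y Z where "X1 = (mfps_X i1 :: ('f, 'n) mfps)" and "X2 = (mfps_X i2 :: ('f, 'n) mfps)"
    and "X3 = (mfps_X i3 :: ('f, 'n) mfps)" and "X4 = (mfps_X i4 :: ('f, 'n) mfps)"
    and "Y = X4 ^ p" and "Z = X1 ^ (p + r)"
  note defs = X1_def X2_def X3_def X4_def Y_def Z_def
  note hom = curve_hom_diff curve_hom_mult curve_hom_X curve_hom_power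
  define D12 D13 D23 h1 h2 where "D12 = X1 * X3 - X2 * X2" and "D13 = X1 * X4 - X2 * X3"
    and "D23 = X2 * X4 - X3 * X3" and "h1 = X3 * (Y * X4) - X1 * (X1 * Z)"
    and "h2 = X4 * (Y * X4) - X2 * (X1 * Z)"
  note gens = D12_def D13_def D23_def h1_def h2_def
  have br: "b * r = 3 * p * r + 5 * r" "b * p = 3 * p * p + 5 * p" by (simp_all add: bq p algebra_simps)
  have "D12 \<in> P" "D13 \<in> P" "D23 \<in> P"
    unfolding gens P_def defining_ideal_iff
    by (simp_all add: defs hom pos_four ai flip: power_add)
  moreover have "a i3 + (a i4 * p + a i4) = a i1 + (a i1 + a i1 * (p + r))"
    using br by (simp add: ai algebra_simps)
  then have "h1 \<in> P"
    unfolding gens P_def defining_ideal_iff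
    by (simp add: defs hom pos_four flip: power_add power_mult)
  ultimately have D: "D12 \<in> P" "D13 \<in> P" "D23 \<in> P" "h1 \<in> P" by blast+
  \<comment> \<open>The cubic expression
    \<open>h1 * D12 * D12 + Y * (D13 * D13 * D13 - D12 * D13 * D23)\<close> vanishes when
    \<open>X1\<close> is set to zero; \<open>- w\<close> is its quotient by
    \<open>X1\<close>.\<close>
  define w where "w = X2 * h2 * D12 - X3 * h1 * D12 - Y * (X4 * D13 * D13 - X3 * D13 * D23)"
  have "X1 * w = - (h1 * D12 * D12) - Y * (D13 * D13 * D13) + Y * (D12 * D13 * D23)"
    unfolding w_def gens by (simp add: algebra_simps)
  also have "\<dots> \<in> ideal_power ?R P 3"
    by (meson D ideal_power_3I ideal_ideal_power[OF id] ideal_add ideal_diff ideal_uminus ideal_mult_left)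
  finally have "w \<in> symbolic_power ?R P 3"
    using mfps_X_notin_defining_ideal[of a i1] pos_four
    by (auto simp: symbolic_power_type P_def X1_def)
  moreover have "w \<notin> ideal_power ?R P 3"
  proof
    define e where "e = (\<lambda>j. if j = i1 then 9 * q + 9 else if j = i2 then 2 * q + 1
      else if j = i3 then q + 2 else 3)"
    have e: "e i1 = 9 * q + 9" "e i2 = 2 * q + 1" "e i3 = q + 2" "e i4 = 3"
      using dist by (auto simp: e_def)
    have epos: "0 < e j" for j by (simp add: e_def)
    \<comment> \<open>The bound \<open>3 * q + 3\<close> is the \<open>e\<close>-weight of
      \<open>X4 ^ (q + 1)\<close>, a term of \<open>h2\<close>. Below it, each set of fixed
      \<open>e\<close>-weight is a union of fibres of \<open>weight a\<close>.\<close>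
    have order: "fps_nth (curve_hom e f) l = 0" if f: "f \<in> P" and l: "l < 3 * q + 3" for f l
      unfolding fps_nth_curve_hom
    proof (rule sum_eq_0_union_of_fibres[where \<kappa> = "weight a"])
      show "finite {m. weight e m = l}"
        using finite_weight[of e l, OF epos] by (simp add: weight_def)
      show "(\<Sum>m | weight a m = x. mfps_nth f m) = 0" for x
        using f by (simp add: P_def defining_ideal_iff flip: fps_nth_curve_hom)
      fix u m assume "u \<in> {m. weight e m = l}" and eq: "weight a m = weight a u"
      then have wu: "weight e u = l" by simp
      then have l': "(9 * q + 9) * u i1 + (2 * q + 1) * u i2 + (q + 2) * u i3 + 3 * u i4 = l"
        by (simp add: weight_four e)
      have u1: "u i1 = 0"
      proof (rule ccontr)
        assume "u i1 \<noteq> 0"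
        then have "(9 * q + 9) * 1 \<le> (9 * q + 9) * u i1" by (intro mult_le_mono2) simp
        also have "\<dots> \<le> l" unfolding l'[symmetric] by simp
        finally show False using l by simp
      qed
      \<comment> \<open>Without \<open>x_i1\<close>, the \<open>e\<close>-weight depends only on the
        degree and on three times the degree minus the index sum, which the weight \<open>a\<close>
        determines in this range.\<close>
      have l'': "3 * (u i2 + u i3 + u i4) + p * (2 * u i2 + u i3) = l"
        using l' u1 by (simp add: p algebra_simps)
      have d: "2 * u i2 + u i3 \<le> 2"
      proof (rule ccontr)
        assume "\<not> 2 * u i2 + u i3 \<le> 2"
        then have 3: "3 \<le> 2 * u i2 + u i3" by simp
        then have low: "p * 3 \<le> p * (2 * u i2 + u i3)" by (rule mult_le_mono2)
        have "2 \<le> u i2 + u i3" using 3 by linarith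
        then have "3 * 2 \<le> 3 * (u i2 + u i3 + u i4)" by simp
        from add_le_mono[OF this low] have "3 * 2 + p * 3 \<le> l" unfolding l'' .
        then show False using l p by simp
      qed
      have "3 * (u i2 + u i3 + u i4) < 3 * (q + 1)" using l l'' by simp
      then have "u i2 + u i3 + u i4 \<le> q" by simp
      then have "u i2 + 2 * u i3 + 3 * u i4 < b" using bq by linarith
      moreover have "3 * u i1 + 2 * u i2 + u i3 \<le> 2" using d u1 by simp
      ultimately have same: "m i1 + m i2 + m i3 + m i4 = u i1 + u i2 + u i3 + u i4"
        "m i2 + 2 * m i3 + 3 * m i4 = u i2 + 2 * u i3 + 3 * u i4"
        by (rule arithmetic_four_unique[OF eq])+
      have m1: "m i1 = 0" using same d u1 by linarith
      have m23: "2 * m i2 + m i3 = 2 * u i2 + u i3"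
        and msum: "m i2 + m i3 + m i4 = u i2 + u i3 + u i4"
        using same m1 u1 by linarith+
      have "weight e m = 3 * (m i2 + m i3 + m i4) + p * (2 * m i2 + m i3)"
        by (simp add: weight_four e m1 p algebra_simps)
      then show "m \<in> {m. weight e m = l}" using l'' by (simp add: m23 msum)
    qed
    assume "w \<in> ideal_power ?R P 3"
    then have "fps_nth (curve_hom e w) (9 * q + 6) = 0"
      using curve_hom_ideal_power_order[of e P "3 * q + 3" w 3 "9 * q + 6"] epos order by simp
    moreover have "fps_nth (curve_hom e w) (9 * q + 6) = - 1"
    proof -
      \<comment> \<open>\<open>A\<close> collects the terms divisible by \<open>X1\<close>; they
        start at \<open>e\<close>-weight \<open>9 * q + 9\<close>. The other three terms all have
        \<open>e\<close>-weight \<open>9 * q + 6\<close>, below the bound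
        \<open>3 * (3 * q + 3)\<close> for the cube, and their signs add up to \<open>- 1\<close> in
        every characteristic.\<close>
      define A where "A = Y * (4 * X2 * X3 * X4 * X4 - 2 * X3 ^ 3 * X4 - X1 * X4 ^ 3)
        + Z * (X2 ^ 4 - 2 * X1 * X2 * X2 * X3 + X1 * X1 * X3 * X3)"
      have "w = X1 * A + Y * (X2 * X3 ^ 4 - X2 ^ 2 * X3 ^ 2 * X4 - X2 ^ 3 * X4 ^ 2)"
        unfolding w_def gens A_def by (simp add: algebra_simps power2_eq_square power3_eq_cube power4_eq_xxxx)
      moreover have "curve_hom e (Y * (X2 * X3 ^ 4)) = fps_X ^ (9 * q + 6)"
        "curve_hom e (Y * (X2 ^ 2 * X3 ^ 2 * X4)) = fps_X ^ (9 * q + 6)"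
        "curve_hom e (Y * (X2 ^ 3 * X4 ^ 2)) = fps_X ^ (9 * q + 6)"
        unfolding defs curve_hom_mult[OF epos] curve_hom_power[OF epos] curve_hom_X[OF epos] e
          power_mult[symmetric] power_add[symmetric]
        by (rule arg_cong[of _ _ "(^) fps_X"], simp add: p)+
      then have "curve_hom e (Y * (X2 * X3 ^ 4 - X2 ^ 2 * X3 ^ 2 * X4 - X2 ^ 3 * X4 ^ 2)) =
          - (fps_X ^ (9 * q + 6))"
        by (simp only: right_diff_distrib curve_hom_diff) simp
      ultimately have "curve_hom e w = fps_X ^ (9 * q + 9) * curve_hom e A - fps_X ^ (9 * q + 6)"
        by (simp add: curve_hom_add curve_hom_mult epos X1_def curve_hom_X e)
      then show ?thesis by (simp add: fps_X_power_mult_nth fps_X_power_nth)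
    qed
    ultimately show False by simp
  qed
  ultimately show ?thesis unfolding P_def by blast
qed

end

lemma property_Q_arithmetic_four:
  fixes a :: "'n :: finite \<Rightarrow> nat"
  assumes a: "curve_exponents a" and four: "arithmetic_four a"
  shows "property_Q TYPE('f :: field) a"
proof -
  have pos: "0 < a i" for i using a by (simp add: curve_exponents_def)
  have nonred: "a j \<noteq> (\<Sum>l\<in>UNIV - {j}. k l * a l)" for j k
    using a by (auto simp: curve_exponents_def)
  obtain b r where br: "0 < b" "0 < r" "coprime b r" and card: "card (UNIV :: 'n set) = 4"
    and range: "range a = {b, b + r, b + 2 * r, b + 3 * r}"
    using four by (auto simp: arithmetic_four_def)
  have "{b, b + r, b + 2 * r, b + 3 * r} \<subseteq> range a" by (simp add: range)
  then obtain i1 i2 i3 i4 where i: "a i1 = b" "a i2 = b + r" "a i3 = b + 2 * r" "a i4 = b + 3 * r"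
    by (auto simp: image_iff)
  have dist: "distinct [i1, i2, i3, i4]" using i br by auto
  then have UNIV: "(UNIV :: 'n set) = {i1, i2, i3, i4}"
    using card by (intro card_subset_eq[symmetric]) auto
  note facts = UNIV dist i br
  \<comment> \<open>The number \<open>b + b * r\<close> is a multiple of \<open>b\<close>. For
    \<open>b = 1, 2, 3\<close> it would be the second, third or fourth exponent, so non-redundancy
    leaves only \<open>b \<ge> 4\<close>.\<close>
  have "a j \<noteq> b + b * r" if "j \<noteq> i1" for j
  proof
    assume "a j = b + b * r"
    then have "a j = (\<Sum>l\<in>UNIV - {j}. (if l = i1 then 1 + r else 0) * a l)"
      using that i(1) by (simp add: if_distrib if_distribR sum.delta algebra_simps cong: if_cong)
    then show False using nonred[of j "\<lambda>l. if l = i1 then 1 + r else 0"] by simp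
  qed
  from this[of i2] this[of i3] this[of i4] have "b \<noteq> 1" "b \<noteq> 2" "b \<noteq> 3"
    using i dist by auto
  then have b4: "4 \<le> b" using br(1) by linarith
  \<comment> \<open>The square argument needs \<open>3 * k + 2 < b\<close>. This allows
    \<open>k = q - 1\<close> for \<open>b = 3 * q + 1\<close> and \<open>k = q\<close> for
    \<open>b = 3 * q + 3\<close>, whereas \<open>k = q\<close> just misses it for
    \<open>b = 3 * q + 2\<close>.\<close>
  define q where "q = (b - 1) div 3"
  consider "b = 3 * q + 1" | "b = 3 * q + 2" | "b = 3 * q + 3" using b4 unfolding q_def by linarith
  then show ?thesis
  proof cases
    case 1
    then obtain p where p: "q = Suc p" using b4 by (cases q) auto
    \<comment> \<open>\<open>X5\<close> stands for a variable of weight \<open>b + 4 * r\<close>,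
      and \<open>(q + r) * b = (q - 1) * (b + 3 * r) + (b + 4 * r)\<close>; so
      \<open>X1 ^ (q + r)\<close> replaces \<open>X4 ^ p * X5\<close>.\<close>
    have "\<exists>w. w \<in> symbolic_power ring_of_type_algebra (defining_ideal a) 2 \<and>
        w \<notin> ideal_power ring_of_type_algebra (defining_ideal a :: ('f, 'n) mfps set) 2"
      by (rule symbolic_square_four[OF facts, where k = p and g = "\<lambda>j. if j = i1 then q + r else 0"])
        (use 1 in \<open>simp_all add: weight_single i p algebra_simps\<close>)
    from property_Q_if_power_ne_symbolic_power[OF pos _ _ this] show ?thesis using card by simp
  next
    case 2
    then have "1 \<le> q" using b4 by linarith
    then have "\<exists>w. w \<in> symbolic_power ring_of_type_algebra (defining_ideal a) 3 \<and>
        w \<notin> ideal_power ring_of_type_algebra (defining_ideal a :: ('f, 'n) mfps set) 3"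
      by (rule symbolic_cube_four[OF facts 2])
    from property_Q_if_power_ne_symbolic_power[OF pos _ _ this] show ?thesis using card by simp
  next
    case 3
    \<comment> \<open>Now \<open>X1 ^ (q + r) * X2\<close> has the weight of
      \<open>X4 ^ q * X5\<close>.\<close>
    define g where "g = (\<lambda>j. if j = i1 then q + r else if j = i2 then 1 else 0)"
    have "weight a g = b * (q + r) + (b + r)"
    proof -
      have "g i1 = q + r" "g i2 = 1" "g i3 = 0" "g i4 = 0" using dist by (auto simp: g_def)
      then show ?thesis by (simp add: weight_four[OF facts] i)
    qed
    then have g: "weight a g + a i3 = (q + 2) * a i4"
      unfolding i 3 by (simp add: algebra_simps)
    have "\<exists>w. w \<in> symbolic_power ring_of_type_algebra (defining_ideal a) 2 \<and>
        w \<notin> ideal_power ring_of_type_algebra (defining_ideal a :: ('f, 'n) mfps set) 2"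
      by (rule symbolic_square_four[OF facts g]) (simp add: 3)
    from property_Q_if_power_ne_symbolic_power[OF pos _ _ this] show ?thesis using card by simp
  qed
qed

theorem corollary2p8:
  shows
    "(\<forall>(a :: 'n :: finite \<Rightarrow> nat) i c.
        curve_exponents a \<and> 0 < c \<and> coprime c (a i) \<and> property_Q TYPE('f :: field) a \<longrightarrow>
        property_Q TYPE('f) (morales i c a)) \<and>
     (\<forall>(a :: 'n \<Rightarrow> nat) b.
        curve_exponents a \<and> (arithmetic_four a \<or> arithmetic_subseq_five a) \<and>
        morales_modification\<^sup>*\<^sup>* a b \<longrightarrow>
        property_Q TYPE('f) b)"
proof (intro conjI allI impI; elim conjE)
  fix a :: "'n \<Rightarrow> nat" and i c
  assume "curve_exponents a" "0 < c" "coprime c (a i)" "property_Q TYPE('f) a"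
  then show "property_Q TYPE('f) (morales i c a)" by (rule property_Q_morales)
next
  fix a b :: "'n \<Rightarrow> nat"
  assume a: "curve_exponents a" "arithmetic_four a \<or> arithmetic_subseq_five a"
    and ab: "morales_modification\<^sup>*\<^sup>* a b"
  \<comment> \<open>The induction also carries \<open>curve_exponents\<close>, which each further
    modification requires of the curve it starts from.\<close>
  from ab have "curve_exponents b \<and> property_Q TYPE('f) b"
  proof (induction rule: rtranclp_induct)
    case base
    then show ?case
      using a property_Q_arithmetic_four property_Q_arithmetic_subseq_five by blast
  next
    case (step b b')
    then show ?case
      using curve_exponents_morales property_Q_morales by (auto simp: morales_modification_def)
  qed
  then show "property_Q TYPE('f) b" ..
qed

end
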